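(* Let $X$ be a (possibly unbounded) self-adjoint operator on a complex Hilbert space $\mathcal H$ with spectral measure $E_X$, and let $Y$ be a bounded operator on $\mathcal H$ with $e^{iX}=e^Y$. (i) If $X$ is generalized $2\pi$-congruence-free, then $E_X(\Omega)\in\{Y\}''$ for all Borel subsets $\Omega\subseteq\mathbb{R}$; in particular $XY=YX$. (ii) If the set $\{(2k+1)\pi: k\in\mathbb{Z}\}\cap\sigma_p(X)$ has at most one element and $Y$ is normal with $\sigma(Y)\subseteq\mathcal S=\{z\in\mathbb{C}: -\pi\le\mathrm{Im}(z)\le\pi\}$, then $XY=YX$. (iii) If $(2k+1)\pi\notin\sigma_p(X)$ for all $k\in\mathbb{Z}$ and $Y$ is normal with $\sigma(Y)\subseteq\mathcal S$, then $Y\in\{e^{iX}\}''$.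
   Context: $\sigma_p(X)$ is the set of eigenvalues of $X$. $e^{iX}$ is the unitary operator defined by the Borel functional calculus. A self-adjoint (possibly unbounded) operator $X$ is called generalized $2\pi$-congruence-free if $E_X(\sigma(X)\cap\sigma(X+2k\pi))=0$ for all $k=\pm1,\pm2,\dots$. For bounded $Y$, $\{Y\}'=\{Z\in B(\mathcal H): ZY=YZ\}$ and $\{Y\}''=\{W\in B(\mathcal H): WZ=ZW \text{ for all } Z\in\{Y\}'\}$. For self-adjoint unbounded $X$ and bounded $Y$, "$XY=YX$" means $YE_X(\Omega)=E_X(\Omega)Y$ for every Borel set $\Omega\subseteq\mathbb{R}$. *)

theory Defs
  imports "HOL-Analysis.Analysis"
begin

text \<open>A complex Hilbert space is encoded as a real Hilbert space (real_inner + complete)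
  with a real-linear isometry imul (multiplication by the imaginary unit) with imul o imul = -id.
  The complex inner product is then inner x y + i * inner x (imul y) (linear in the first,
  conjugate-linear in the second argument), and its real part is the real inner product.\<close>

class chilbert = real_inner + complete_space +
  fixes imul :: "'a \<Rightarrow> 'a"
  assumes imul_add: "imul (x + y) = imul x + imul y"
    and imul_scaleR: "imul (r *\<^sub>R x) = r *\<^sub>R imul x"
    and imul_imul: "imul (imul x) = - x"
    and inner_imul: "inner (imul x) (imul y) = inner x y"

definition cscale :: "complex \<Rightarrow> 'a::chilbert \<Rightarrow> 'a" where
  "cscale c x = Re c *\<^sub>R x + Im c *\<^sub>R imul x"

definition cinner :: "'a::chilbert \<Rightarrow> 'a \<Rightarrow> complex" where
  "cinner x y = Complex (inner x y) (inner x (imul y))"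

definition bop :: "('a::chilbert \<Rightarrow> 'a) \<Rightarrow> bool" where
  "bop T \<longleftrightarrow> bounded_linear T \<and> (\<forall>x. T (imul x) = imul (T x))"

definition self_adjoint :: "'a::chilbert set \<Rightarrow> ('a \<Rightarrow> 'a) \<Rightarrow> bool" where
  "self_adjoint D X \<longleftrightarrow>
     0 \<in> D \<and> (\<forall>x\<in>D. \<forall>y\<in>D. x + y \<in> D) \<and> (\<forall>c. \<forall>x\<in>D. cscale c x \<in> D)
   \<and> closure D = UNIV
   \<and> (\<forall>x\<in>D. \<forall>y\<in>D. X (x + y) = X x + X y)
   \<and> (\<forall>c. \<forall>x\<in>D. X (cscale c x) = cscale c (X x))
   \<and> (\<forall>x\<in>D. \<forall>y\<in>D. cinner (X x) y = cinner x (X y))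
   \<and> (\<forall>y z. (\<forall>x\<in>D. cinner (X x) y = cinner x z) \<longrightarrow> y \<in> D \<and> X y = z)"

definition pvm :: "(real set \<Rightarrow> 'a::chilbert \<Rightarrow> 'a) \<Rightarrow> bool" where
  "pvm E \<longleftrightarrow>
     (\<forall>\<Omega>\<in>sets borel. bop (E \<Omega>) \<and> E \<Omega> \<circ> E \<Omega> = E \<Omega>
         \<and> (\<forall>x y. cinner (E \<Omega> x) y = cinner x (E \<Omega> y)))
   \<and> E UNIV = id \<and> E {} = (\<lambda>x. 0)
   \<and> (\<forall>A. range A \<subseteq> sets borel \<longrightarrow> disjoint_family A \<longrightarrow>
         (\<forall>x. (\<lambda>n. \<Sum>k<n. E (A k) x) \<longlonglongrightarrow> E (\<Union>(range A)) x))"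

text \<open>The positive finite measure Omega |-> <E(Omega)x,x> = norm (E(Omega) x)^2.\<close>
definition mu :: "(real set \<Rightarrow> 'a::chilbert \<Rightarrow> 'a) \<Rightarrow> 'a \<Rightarrow> real measure" where
  "mu E x = measure_of UNIV (sets borel) (\<lambda>\<Omega>. ennreal ((norm (E \<Omega> x))\<^sup>2))"

text \<open>T is the (bounded) Borel functional calculus integral of f against E:
  <T x, x> = integral of f d<E x,x> for all x (this determines T in a complex Hilbert space).\<close>
definition spectral_integral ::
  "(real set \<Rightarrow> 'a::chilbert \<Rightarrow> 'a) \<Rightarrow> (real \<Rightarrow> complex) \<Rightarrow> ('a \<Rightarrow> 'a) \<Rightarrow> bool" where
  "spectral_integral E f T \<longleftrightarrow> bop T \<and> (\<forall>x. cinner (T x) x = integral\<^sup>L (mu E x) f)"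

definition spectral_measure_of ::
  "(real set \<Rightarrow> 'a::chilbert \<Rightarrow> 'a) \<Rightarrow> 'a set \<Rightarrow> ('a \<Rightarrow> 'a) \<Rightarrow> bool" where
  "spectral_measure_of E D X \<longleftrightarrow> pvm E
     \<and> D = {x. integrable (mu E x) (\<lambda>t. t\<^sup>2)}
     \<and> (\<forall>x\<in>D. cinner (X x) x = complex_of_real (\<integral>t. t \<partial>(mu E x)))"

text \<open>Spectrum of an (unbounded) operator, restricted to real points (the spectrum of a
  self-adjoint operator is real): X - t is not a bijection D -> H with bounded inverse.\<close>
definition uspectrum :: "'a::chilbert set \<Rightarrow> ('a \<Rightarrow> 'a) \<Rightarrow> real set" where
  "uspectrum D X = {t. \<not> (\<exists>R. bop R \<and> (\<forall>x. R x \<in> D \<and> X (R x) - t *\<^sub>R R x = x)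
                              \<and> (\<forall>x\<in>D. R (X x - t *\<^sub>R x) = x))}"

definition point_spectrum :: "'a::chilbert set \<Rightarrow> ('a \<Rightarrow> 'a) \<Rightarrow> real set" where
  "point_spectrum D X = {t. \<exists>x\<in>D. x \<noteq> 0 \<and> X x = t *\<^sub>R x}"

definition bspectrum :: "('a::chilbert \<Rightarrow> 'a) \<Rightarrow> complex set" where
  "bspectrum Y = {z. \<not> (\<exists>R. bop R \<and> (\<forall>x. Y (R x) - cscale z (R x) = x)
                              \<and> (\<forall>x. R (Y x - cscale z x) = x))}"

definition gen_2pi_congruence_free ::
  "(real set \<Rightarrow> 'a::chilbert \<Rightarrow> 'a) \<Rightarrow> 'a set \<Rightarrow> ('a \<Rightarrow> 'a) \<Rightarrow> bool" where
  "gen_2pi_congruence_free E D X \<longleftrightarrow>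
     (\<forall>k::int. k \<noteq> 0 \<longrightarrow>
        E (uspectrum D X \<inter> uspectrum D (\<lambda>x. X x + (2 * of_int k * pi) *\<^sub>R x)) = (\<lambda>x. 0))"

definition op_exp :: "('a::chilbert \<Rightarrow> 'a) \<Rightarrow> 'a \<Rightarrow> 'a" where
  "op_exp Y x = (\<Sum>n. (1 / fact n) *\<^sub>R (Y ^^ n) x)"

definition adjoint_of :: "('a::chilbert \<Rightarrow> 'a) \<Rightarrow> ('a \<Rightarrow> 'a) \<Rightarrow> bool" where
  "adjoint_of Y Ys \<longleftrightarrow> bop Ys \<and> (\<forall>x y. cinner (Y x) y = cinner x (Ys y))"

definition normal_op :: "('a::chilbert \<Rightarrow> 'a) \<Rightarrow> bool" where
  "normal_op Y \<longleftrightarrow> bop Y \<and> (\<exists>Ys. adjoint_of Y Ys \<and> Y \<circ> Ys = Ys \<circ> Y)"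

definition commutant :: "('a::chilbert \<Rightarrow> 'a) set \<Rightarrow> ('a \<Rightarrow> 'a) set" where
  "commutant S = {Z. bop Z \<and> (\<forall>W\<in>S. Z \<circ> W = W \<circ> Z)}"

text \<open>"XY = YX" for self-adjoint X (spectral measure E) and bounded Y.\<close>
definition commutes_sa :: "(real set \<Rightarrow> 'a::chilbert \<Rightarrow> 'a) \<Rightarrow> ('a \<Rightarrow> 'a) \<Rightarrow> bool" where
  "commutes_sa E Y \<longleftrightarrow> (\<forall>\<Omega>\<in>sets borel. Y \<circ> E \<Omega> = E \<Omega> \<circ> Y)"

end

theory Submission
  imports Defs
begin

text \<open>Write \<open>U = exp Y\<close>. A vector \<open>x\<close> lies in the spectral subspace of \<open>U\<close> for an arc
  \<open>{z. |z - w| \<le> r}\<close> of the unit circle iff \<open>(U - w)\<^sup>n x\<close> grows at most like \<open>r\<^sup>n\<close>, so every bounded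
  operator commuting with \<open>U\<close> commutes with \<open>E (cis -` C)\<close> for closed \<open>C\<close>. If \<open>X\<close> is generalized
  congruence-free, the \<open>2\<pi>\<close>-translates of the spectrum overlap in null sets only, hence
  \<open>E [a, b] = E (cis -` cis ([a, b] \<inter> \<sigma>(X)))\<close>, which gives (i).

  If \<open>Y\<close> is normal then \<open>exp (Y + Y\<^sup>*) = U\<^sup>* U = 1\<close> forces \<open>Y\<^sup>* = - Y\<close>, and the spectral condition becomes
  \<open>\<parallel>Y\<parallel> \<le> \<pi>\<close>. Hence \<open>V = exp (Y / 2)\<close> satisfies \<open>V\<^sup>2 = U\<close> and \<open>Re V \<ge> 0\<close>, with a positive lower bound on spectral
  subspaces of \<open>U\<close> away from \<open>-1\<close>. If \<open>Z\<close> commutes with \<open>U\<close>, then \<open>W = V Z - Z V\<close> solves \<open>V W + W V = 0\<close>,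
  so \<open>W\<close> vanishes on these subspaces. Repeating this for the roots \<open>exp (Y / 2\<^sup>n)\<close> and differentiating shows that
  \<open>Z\<close> commutes with \<open>Y\<close> off the eigenspace of \<open>U\<close> for \<open>-1\<close>; parts (ii) and (iii) follow.\<close>

section \<open>Complex Hilbert spaces and resolutions of the identity\<close>

instance chilbert \<subseteq> banach ..

lemma bounded_linear_imul: "bounded_linear (imul :: 'a::chilbert \<Rightarrow> 'a)"
  by (rule bounded_linear_intro[where K = 1])
     (simp_all add: imul_add imul_scaleR norm_eq_sqrt_inner inner_imul)

lemma norm_imul [simp]: "norm (imul x) = norm x"
  by (simp add: norm_eq_sqrt_inner inner_imul)

lemma imul_minus: "imul (- x) = - imul x"
  and imul_diff: "imul (x - y) = imul x - imul y"
  and imul_zero [simp]: "imul 0 = 0"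
  using linear_neg linear_diff linear_0 bounded_linear.linear[OF bounded_linear_imul] by blast+

lemma inner_imul_left: "inner (imul x) y = - inner x (imul y)"
  by (metis inner_imul imul_imul inner_minus_left minus_minus)

lemma inner_imul_self [simp]: "inner x (imul x) = 0"
  using inner_imul_left[of x x] by (simp add: inner_commute)

lemma cscale_of_real: "cscale (of_real r) x = r *\<^sub>R x" and cscale_i: "cscale \<i> x = imul x"
  by (simp_all add: cscale_def)

lemma norm_cscale: "norm (cscale c x) = cmod c * norm x"
proof (rule power2_eq_imp_eq)
  have "(norm (cscale c x))\<^sup>2 = inner (cscale c x) (cscale c x)"
    by (rule power2_norm_eq_inner)
  also have "\<dots> = ((Re c)\<^sup>2 + (Im c)\<^sup>2) * inner x x"
    unfolding cscale_def inner_add_left inner_add_right inner_scaleR_left inner_scaleR_right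
      inner_imul inner_imul_left inner_imul_self imul_imul inner_minus_right
    by (simp add: power2_eq_square distrib_right)
  finally show "(norm (cscale c x))\<^sup>2 = (cmod c * norm x)\<^sup>2"
    by (simp only: power_mult_distrib cmod_power2 power2_norm_eq_inner[of x])
qed simp_all

lemma bop_add: "bop T \<Longrightarrow> T (x + y) = T x + T y"
  and bop_diff: "bop T \<Longrightarrow> T (x - y) = T x - T y"
  and bop_minus: "bop T \<Longrightarrow> T (- x) = - T x"
  and bop_scaleR: "bop T \<Longrightarrow> T (r *\<^sub>R x) = r *\<^sub>R T x"
  and bop_zero: "bop T \<Longrightarrow> T 0 = 0"
  and bop_imul: "bop T \<Longrightarrow> T (imul x) = imul (T x)"
  unfolding bop_def
  by (auto simp: linear_simps bounded_linear.linear linear_neg)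

lemma bop_cscale: "bop T \<Longrightarrow> T (cscale c x) = cscale c (T x)"
  by (simp add: cscale_def bop_add bop_scaleR bop_imul)

lemma bop_bounded_linear: "bop T \<Longrightarrow> bounded_linear T"
  by (simp add: bop_def)

lemma bop_tendsto: "bop T \<Longrightarrow> (f \<longlongrightarrow> a) F \<Longrightarrow> ((\<lambda>x. T (f x)) \<longlongrightarrow> T a) F"
  using bounded_linear.tendsto[OF bop_bounded_linear] by blast

section \<open>Algebra of a projection-valued measure\<close>

locale spectral_resolution =
  fixes E :: "real set \<Rightarrow> 'a::chilbert \<Rightarrow> 'a"
  assumes pvm: "pvm E"
begin

lemma bop_E: "A \<in> sets borel \<Longrightarrow> bop (E A)"
  and E_idem: "A \<in> sets borel \<Longrightarrow> E A (E A x) = E A x"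
  and E_UNIV [simp]: "E UNIV x = x"
  and E_empty [simp]: "E {} x = 0"
  using pvm unfolding pvm_def by (auto simp: fun_eq_iff)

lemma E_adjoint: "A \<in> sets borel \<Longrightarrow> inner (E A x) y = inner x (E A y)"
  using pvm unfolding pvm_def cinner_def by auto

lemmas E_linear = bop_add[OF bop_E] bop_diff[OF bop_E] bop_minus[OF bop_E]
  bop_scaleR[OF bop_E] bop_zero[OF bop_E] bop_imul[OF bop_E]

lemma E_countable_additive:
  "range A \<subseteq> sets borel \<Longrightarrow> disjoint_family A \<Longrightarrow> (\<lambda>k. E (A k) x) sums E (\<Union>(range A)) x"
  using pvm unfolding pvm_def sums_def by simp

lemma E_Un:
  assumes [measurable]: "A \<in> sets borel" "B \<in> sets borel" and "A \<inter> B = {}"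
  shows "E (A \<union> B) x = E A x + E B x"
proof -
  have "(\<lambda>k. E (binaryset A B k) x) sums E (\<Union>(range (binaryset A B))) x"
    by (rule E_countable_additive)
       (use assms in \<open>auto simp: range_binaryset_eq disjoint_family_on_def binaryset_def\<close>)
  moreover have "(\<lambda>k. E (binaryset A B k) x) sums (\<Sum>k<2. E (binaryset A B k) x)"
    by (rule sums_finite) (auto simp: binaryset_def)
  ultimately show ?thesis
    using sums_unique2 by (fastforce simp: UN_binaryset_eq numeral_2_eq_2 binaryset_def)
qed

text \<open>By additivity \<open>E A + E B\<close> is a projection, and expanding its square gives
  \<open>E A E B + E B E A = 0\<close>. Multiplying this by \<open>E A\<close> from the left and
  from the right shows that the two projections also commute, so their product is zero.\<close>

lemma E_disjoint:
  assumes AB [measurable]: "A \<in> sets borel" "B \<in> sets borel" and disj: "A \<inter> B = {}"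
  shows "E A (E B x) = 0"
proof -
  have sq: "E A (E B y) + E B (E A y) = 0" for y
  proof -
    have "E (A \<union> B) (E (A \<union> B) y) = E (A \<union> B) y" by (rule E_idem) simp
    then show ?thesis
      by (simp add: E_Un[OF AB disj] E_linear AB E_idem)
  qed
  have "E A (E B x) = - E A (E B (E A x))"
  proof -
    have "E A (E A (E B x) + E B (E A x)) = 0" using sq by (simp add: E_linear)
    then show ?thesis by (simp add: E_linear E_idem eq_neg_iff_add_eq_0)
  qed
  moreover have "E A (E B (E A x)) = - E B (E A x)"
    using sq[of "E A x"] by (simp add: E_idem eq_neg_iff_add_eq_0)
  ultimately have "E A (E B x) = E B (E A x)" by simp
  with sq[of x] have "2 *\<^sub>R E A (E B x) = 0" by (simp add: scaleR_2)
  then show ?thesis by simp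
qed

lemma E_Int:
  assumes [measurable]: "A \<in> sets borel" "B \<in> sets borel"
  shows "E A (E B x) = E (A \<inter> B) x"
proof -
  have "E A (E B x) = E A (E (A \<inter> B) x + E (B - A) x)"
    by (subst E_Un[symmetric]) (auto intro!: arg_cong[where f = "\<lambda>S. E A (E S x)"])
  also have "\<dots> = E A (E (A \<inter> B) x)"
    by (simp add: E_linear E_disjoint)
  also have "\<dots> = E ((A \<inter> B) \<union> (A - B)) (E (A \<inter> B) x)"
    by (simp add: Int_Diff_Un)
  also have "\<dots> = E (A \<inter> B) x"
    by (subst E_Un) (auto simp: E_idem intro!: E_disjoint)
  finally show ?thesis .
qed

lemma E_Compl: "A \<in> sets borel \<Longrightarrow> E (- A) x = x - E A x"
  using E_Un[of A "- A" x] by (simp add: Compl_partition algebra_simps)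

lemma norm_E_sq: "A \<in> sets borel \<Longrightarrow> (norm (E A x))\<^sup>2 = inner (E A x) x"
  by (metis E_adjoint E_idem power2_norm_eq_inner)

lemma norm_E_le:
  assumes "A \<in> sets borel"
  shows "norm (E A x) \<le> norm x"
proof -
  have "(norm (E A x))\<^sup>2 \<le> norm (E A x) * norm x"
    using norm_E_sq[OF assms] norm_cauchy_schwarz by metis
  then show ?thesis
    by (cases "E A x = 0") (auto simp: power2_eq_square)
qed

section \<open>Scalar measures attached to a vector\<close>

lemma space_mu [simp]: "space (mu E x) = UNIV"
  and sets_mu [simp, measurable_cong]: "sets (mu E x) = sets borel"
proof -
  have "sigma_sets UNIV (sets (borel :: real measure)) = sets borel"
    using sets.sigma_sets_eq[of "borel :: real measure"] by simp
  then show "space (mu E x) = UNIV" "sets (mu E x) = sets borel"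
    by (simp_all add: mu_def sets_measure_of_conv)
qed

lemma norm_E_sums:
  assumes A: "range A \<subseteq> sets borel" "disjoint_family A"
  shows "(\<lambda>k. (norm (E (A k) x))\<^sup>2) sums (norm (E (\<Union>(range A)) x))\<^sup>2"
proof -
  have "(\<lambda>k. inner (E (A k) x) x) sums inner (E (\<Union>(range A)) x) x"
    by (rule bounded_linear.sums[OF bounded_linear_inner_left E_countable_additive[OF A]])
  then show ?thesis
    using A by (subst (1 2) norm_E_sq) auto
qed

text \<open>\<open>measure_of\<close> reproduces the given set function only if it is countably
  additive. This follows from the strong additivity of \<open>E\<close> by pairing with
  \<open>x\<close>, as the squared norm of \<open>E A x\<close> equals
  \<open>inner (E A x) x\<close>.\<close>

lemma emeasure_mu:
  assumes "A \<in> sets borel"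
  shows "emeasure (mu E x) A = ennreal ((norm (E A x))\<^sup>2)"
proof -
  have "countably_additive (sets borel) (\<lambda>A. ennreal ((norm (E A x))\<^sup>2))"
  proof (rule countably_additiveI)
    fix A :: "nat \<Rightarrow> real set"
    assume A: "range A \<subseteq> sets borel" "disjoint_family A" "\<Union>(range A) \<in> sets borel"
    show "(\<Sum>k. ennreal ((norm (E (A k) x))\<^sup>2)) = ennreal ((norm (E (\<Union>(range A)) x))\<^sup>2)"
      by (intro suminf_ennreal_eq norm_E_sums A) auto
  qed
  moreover have "positive (sets borel) (\<lambda>A. ennreal ((norm (E A x))\<^sup>2))"
    by (simp add: positive_def)
  moreover have "sigma_algebra UNIV (sets (borel :: real measure))"
    using sets.sigma_algebra_axioms[of "borel :: real measure"] by simp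
  ultimately show ?thesis
    using assms unfolding mu_def by (subst emeasure_measure_of_sigma) auto
qed

lemma finite_measure_mu: "finite_measure (mu E x)"
  by (rule finite_measureI) (simp add: emeasure_mu)

lemma measure_mu: "A \<in> sets borel \<Longrightarrow> measure (mu E x) A = (norm (E A x))\<^sup>2"
  by (simp add: measure_def emeasure_mu)

lemma mu_E:
  assumes [measurable]: "A \<in> sets borel"
  shows "mu E (E A x) = density (mu E x) (\<lambda>t. ennreal (indicator A t))"
proof -
  have "mu E (E A x) = density (mu E x) (indicator A)"
    by (rule measure_eqI) (simp_all add: emeasure_mu emeasure_density E_Int Int_commute
        flip: indicator_inter_arith)
  also have "indicator A = (\<lambda>t. ennreal (indicator A t))"
    by (rule ext) (simp split: split_indicator)
  finally show ?thesis .
qed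

lemma AE_mu_range:
  assumes A [measurable]: "A \<in> sets borel" and "E A x = x"
  shows "AE t in mu E x. t \<in> A"
proof -
  have "E (- A) x = 0" using assms by (simp add: E_Compl)
  then have "- A \<in> null_sets (mu E x)" by (auto simp: null_sets_def emeasure_mu)
  then show ?thesis by (auto intro: AE_I')
qed

text \<open>The squared norm of the missing part is its mass under the finite measure
  \<open>mu E x\<close>, so continuity from above at the empty set gives norm convergence.\<close>

lemma E_incseq:
  assumes A: "range A \<subseteq> sets borel" "incseq A"
  shows "(\<lambda>n. E (A n) x) \<longlonglongrightarrow> E (\<Union>(range A)) x"
proof -
  interpret finite_measure "mu E x" by (rule finite_measure_mu)
  let ?U = "\<Union>(range A)"
  have [measurable]: "A n \<in> sets borel" for n using A by auto
  have U: "?U \<in> sets borel" by measurable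
  have "(\<lambda>n. measure (mu E x) (?U - A n)) \<longlonglongrightarrow> measure (mu E x) (\<Inter>n. ?U - A n)"
    using A by (intro Lim_measure_decseq) (auto simp: decseq_def incseq_def fmeasurable_eq_sets)
  moreover have "(\<Inter>n. ?U - A n) = {}" by auto
  ultimately have "(\<lambda>n. (norm (E (?U - A n) x))\<^sup>2) \<longlonglongrightarrow> 0"
    using U by (simp add: measure_mu)
  then have "(\<lambda>n. sqrt ((norm (E (?U - A n) x))\<^sup>2)) \<longlonglongrightarrow> sqrt 0"
    by (rule tendsto_real_sqrt)
  then have "(\<lambda>n. E (?U - A n) x) \<longlonglongrightarrow> 0"
    by (simp add: tendsto_norm_zero_iff)
  moreover have "E (?U - A n) x = E ?U x - E (A n) x" for n
    using E_Un[of "A n" "?U - A n" x] U by (simp add: Un_absorb1 UN_upper)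
  ultimately have "(\<lambda>n. E ?U x - (E ?U x - E (A n) x)) \<longlonglongrightarrow> E ?U x - 0"
    by (intro tendsto_diff) auto
  then show ?thesis by simp
qed

lemma E_null_mono:
  assumes [measurable]: "A \<in> sets borel" "B \<in> sets borel" and "A \<subseteq> B" "\<And>x. E B x = 0"
  shows "E A x = 0"
  using E_Int[of A B x] assms by (simp add: Int_absorb2 E_linear)

lemma E_null_UN:
  assumes "countable I" and [measurable]: "\<And>i. i \<in> I \<Longrightarrow> A i \<in> sets borel"
    and null: "\<And>i. i \<in> I \<Longrightarrow> E (A i) x = 0"
  shows "E (\<Union>i\<in>I. A i) x = 0"
proof -
  have "(\<Union>i\<in>I. A i) \<in> null_sets (mu E x)"
    using assms by (intro null_sets_UN') (auto simp: null_sets_def emeasure_mu)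
  moreover have "(\<Union>i\<in>I. A i) \<in> sets borel" using assms by auto
  ultimately show ?thesis by (auto simp: null_sets_def emeasure_mu)
qed

text \<open>Reduces commutation with all spectral projections to a generator of the Borel sets.
  Complements and disjoint unions give a Dynkin system, and \<open>E_Int\<close> makes it stable
  under intersections.\<close>

lemma sigma_algebra_commutant:
  assumes Z: "bop Z"
  shows "sigma_algebra UNIV {A \<in> sets borel. \<forall>x. Z (E A x) = E A (Z x)}"
proof -
  let ?M = "{A \<in> sets borel. \<forall>x. Z (E A x) = E A (Z x)}"
  have Int: "A \<inter> B \<in> ?M" if "A \<in> ?M" "B \<in> ?M" for A B
    using that by (auto simp flip: E_Int)
  have compl: "- A \<in> ?M" if "A \<in> ?M" for A
    using that by (auto simp: E_Compl bop_diff Z)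
  have UN: "\<Union>(range A) \<in> ?M" if A: "range A \<subseteq> ?M" "disjoint_family A" for A :: "nat \<Rightarrow> real set"
  proof -
    have "Z (E (\<Union>(range A)) x) = E (\<Union>(range A)) (Z x)" for x
    proof (rule sums_unique2)
      show "(\<lambda>k. Z (E (A k) x)) sums Z (E (\<Union>(range A)) x)"
        using A by (intro bounded_linear.sums[OF bop_bounded_linear[OF Z]] E_countable_additive) auto
      have "(\<lambda>k. E (A k) (Z x)) sums E (\<Union>(range A)) (Z x)"
        using A by (intro E_countable_additive) auto
      then show "(\<lambda>k. Z (E (A k) x)) sums E (\<Union>(range A)) (Z x)"
        using A by (subst sums_cong) auto
    qed
    moreover have "\<Union>(range A) \<in> sets borel" using A by auto
    ultimately show ?thesis by simp
  qed
  interpret Dynkin_system UNIV ?M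
  proof (rule Dynkin_systemI')
    show "{} \<in> ?M" by (simp add: bop_zero Z)
    show "UNIV - A \<in> ?M" if "A \<in> ?M" for A using compl[OF that] by (simp add: Compl_eq_Diff_UNIV)
  qed (use UN in auto)
  show ?thesis
    using Int by (simp add: sigma_algebra_eq_Int_stable Int_stable_def)
qed

end

section \<open>Operators represented by a quadratic form\<close>

lemma dense_orthogonal_eq_zero:
  fixes z :: "'a::real_inner"
  assumes "closure D = UNIV" "\<And>y. y \<in> D \<Longrightarrow> inner z y = 0"
  shows "z = 0"
proof -
  have "closed {y. inner z y = 0}" by (intro closed_Collect_eq continuous_intros)
  then have "closure D \<subseteq> {y. inner z y = 0}" using assms(2) by (intro closure_minimal) auto
  with assms(1) have "inner z z = 0" by blast
  then show ?thesis by simp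
qed

text \<open>Common ground for the unitary operator (\<open>D = UNIV\<close>, \<open>f = cis\<close>)
  and the self-adjoint one (\<open>f\<close> the embedding of the reals). The measure determines
  only the quadratic form of \<open>T\<close>, so commutation with \<open>E\<close> and norm
  estimates are extracted from it by polarization.\<close>

locale spectral_operator = spectral_resolution E
  for E :: "real set \<Rightarrow> 'a::chilbert \<Rightarrow> 'a" +
  fixes D :: "'a set" and T :: "'a \<Rightarrow> 'a" and f :: "real \<Rightarrow> complex"
  assumes D_add: "x \<in> D \<Longrightarrow> y \<in> D \<Longrightarrow> x + y \<in> D"
    and D_scaleR: "x \<in> D \<Longrightarrow> r *\<^sub>R x \<in> D"
    and D_imul: "x \<in> D \<Longrightarrow> imul x \<in> D"
    and D_dense: "closure D = UNIV"
    and D_E: "A \<in> sets borel \<Longrightarrow> x \<in> D \<Longrightarrow> E A x \<in> D"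
    and T_add: "x \<in> D \<Longrightarrow> y \<in> D \<Longrightarrow> T (x + y) = T x + T y"
    and T_scaleR: "x \<in> D \<Longrightarrow> T (r *\<^sub>R x) = r *\<^sub>R T x"
    and T_imul: "x \<in> D \<Longrightarrow> T (imul x) = imul (T x)"
    and f_measurable [measurable]: "f \<in> borel_measurable borel"
    and f_integrable: "x \<in> D \<Longrightarrow> integrable (mu E x) f"
    and form: "x \<in> D \<Longrightarrow> cinner (T x) x = integral\<^sup>L (mu E x) f"
begin

lemma integral_mu_E:
  assumes [measurable]: "A \<in> sets borel"
  shows "integral\<^sup>L (mu E (E A x)) f = (\<integral>t. indicator A t *\<^sub>R f t \<partial>mu E x)"
  by (simp add: mu_E integral_density)

lemma form_split:
  assumes A [measurable]: "A \<in> sets borel" and x: "x \<in> D"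
  shows "cinner (T x) x = cinner (T (E A x)) (E A x) + cinner (T (E (- A) x)) (E (- A) x)"
proof -
  note [simp] = f_integrable[OF x]
  have "integral\<^sup>L (mu E x) f = (\<integral>t. indicator A t *\<^sub>R f t + indicator (- A) t *\<^sub>R f t \<partial>mu E x)"
    by (rule Bochner_Integration.integral_cong) (auto simp: indicator_def)
  also have "\<dots> = integral\<^sup>L (mu E (E A x)) f + integral\<^sup>L (mu E (E (- A) x)) f"
    by (subst Bochner_Integration.integral_add)
       (auto simp: integral_mu_E intro!: integrable_mult_indicator[of _ "mu E x", simplified])
  finally show ?thesis using x A by (simp add: form D_E)
qed

text \<open>By \<open>form_split\<close> the quadratic form has no cross terms between the range of
  \<open>E A\<close> and its complement. Polarizing with both \<open>y\<close> and
  \<open>imul y\<close> separates \<open>inner (T x) y\<close> from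
  \<open>inner (T y) x\<close>.\<close>

lemma form_orthogonal:
  assumes A: "A \<in> sets borel" and x: "x \<in> D" "E A x = x" and y: "y \<in> D" "E A y = 0"
  shows "inner (T x) y = 0"
proof -
  have *: "inner (T x) y + inner (T y) x = 0 \<and> inner (T x) (imul y) + inner (T y) (imul x) = 0"
    if "y \<in> D" "E A y = 0" for y
  proof -
    have "E A (x + y) = x" "E (- A) (x + y) = y"
      using that x A by (simp_all add: E_Compl E_linear)
    then have "cinner (T x + T y) (x + y) = cinner (T x) x + cinner (T y) y"
      using form_split[OF A D_add[OF x(1) that(1)]] by (simp add: T_add x that)
    then show ?thesis
      by (simp add: cinner_def complex_eq_iff inner_add_left inner_add_right imul_add)
  qed
  have "inner (T x) (imul z) = 0" if "z \<in> D" "E A z = 0" for z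
    using *[OF that] *[of "imul z"] that A
    by (simp add: D_imul E_linear T_imul inner_imul_left imul_imul)
  from this[of "imul y"] show ?thesis
    using y A by (simp add: D_imul E_linear imul_imul)
qed

text \<open>By \<open>form_orthogonal\<close> and density of \<open>D\<close>, \<open>T\<close>
  sends the part of \<open>D\<close> in the range of \<open>E B\<close> into that range. Taking for
  \<open>B\<close> the set \<open>A\<close> and its complement gives commutation.\<close>

lemma E_T_commute:
  assumes A: "A \<in> sets borel" and x: "x \<in> D"
  shows "E A (T x) = T (E A x)"
proof -
  have vanish: "E (- B) (T (E B x)) = 0" if B: "B \<in> sets borel" for B
  proof (rule dense_orthogonal_eq_zero[OF D_dense])
    fix y assume y: "y \<in> D"
    have "inner (T (E B x)) (E (- B) y) = 0"
      using B x y by (intro form_orthogonal[of B]) (auto simp: D_E E_idem E_disjoint)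
    then show "inner (E (- B) (T (E B x))) y = 0"
      using B by (simp add: E_adjoint)
  qed
  have "T x = T (E A x) + T (E (- A) x)"
    using A D_E[OF A x] D_E[of "- A", OF _ x] by (subst T_add[symmetric]) (auto simp: E_Compl)
  then show ?thesis
    using vanish[of A] vanish[of "- A"] A by (simp add: E_linear E_Compl)
qed

lemma form_bound:
  assumes A [measurable]: "A \<in> sets borel" and x: "x \<in> D" "E A x = x"
    and f: "\<And>t. t \<in> A \<Longrightarrow> cmod (f t - c) \<le> e"
  shows "cmod (cinner (T x - cscale c x) x) \<le> e * (norm x)\<^sup>2"
proof -
  interpret finite_measure "mu E x" by (rule finite_measure_mu)
  note [simp] = f_integrable[OF x(1)]
  have mx: "measure (mu E x) UNIV = (norm x)\<^sup>2" by (simp add: measure_mu)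
  have "cinner (T x - cscale c x) x = cinner (T x) x - c * of_real ((norm x)\<^sup>2)"
    by (simp add: cinner_def cscale_def complex_eq_iff inner_diff_left inner_add_left inner_imul_left
        inner_imul imul_imul power2_norm_eq_inner)
  also have "\<dots> = (\<integral>t. f t - c \<partial>mu E x)"
    by (subst Bochner_Integration.integral_diff)
       (simp_all add: form x mx scaleR_conv_of_real mult.commute)
  also have "cmod \<dots> \<le> (\<integral>t. cmod (f t - c) \<partial>mu E x)"
    by (rule integral_norm_bound)
  also have "\<dots> \<le> (\<integral>t. e \<partial>mu E x)"
    by (rule integral_mono_AE) (use AE_mu_range[OF A x(2)] f in auto)
  finally show ?thesis by (simp add: mx mult.commute)
qed

text \<open>On the range of \<open>E A\<close> the numerical radius of \<open>T - c\<close> is at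
  most \<open>e\<close>, and a norm is at most twice the numerical radius. The symmetric and the
  antisymmetric part of the real form \<open>inner (N y) z\<close> are bounded separately and then
  added.\<close>

lemma norm_bound:
  assumes A: "A \<in> sets borel" and ran: "\<And>x. E A x \<in> D" and x: "E A x = x"
    and f: "\<And>t. t \<in> A \<Longrightarrow> cmod (f t - c) \<le> e" and e: "0 < e"
  shows "norm (T x - cscale c x) \<le> 2 * e * norm x"
proof -
  define N where "N x = T x - cscale c x" for x
  have D: "y \<in> D" if "E A y = y" for y using ran[of y] that by simp
  have N_add: "N (y + z) = N y + N z" and N_imul: "N (imul y) = imul (N y)"
    and N_scaleR: "N (r *\<^sub>R y) = r *\<^sub>R N y"
    if "E A y = y" "E A z = z" for y z r
    using D[OF that(1)] D[OF that(2)]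
    by (simp_all add: N_def T_add T_imul T_scaleR cscale_def imul_add imul_diff imul_scaleR imul_imul algebra_simps)
  have q: "\<bar>inner (N y) y\<bar> \<le> e * (norm y)\<^sup>2" "\<bar>inner (N y) (imul y)\<bar> \<le> e * (norm y)\<^sup>2"
    if "E A y = y" for y
    using form_bound[OF A D[OF that] that f] abs_Re_le_cmod[of "cinner (N y) y"]
      abs_Im_le_cmod[of "cinner (N y) y"]
    by (auto simp: N_def cinner_def)
  have *: "inner (N y) z + inner (N z) y \<le> e * ((norm y)\<^sup>2 + (norm z)\<^sup>2)"
    if yz: "E A y = y" "E A z = z" for y z
  proof -
    have m: "E A (- z) = - z" using yz A by (simp add: E_linear)
    have "N (y + - z) = N y - N z"
      using N_add[OF yz(1) m] N_scaleR[OF yz(2) yz(2), of "-1"] by simp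
    then have "2 * (inner (N y) z + inner (N z) y) = inner (N (y + z)) (y + z) - inner (N (y + - z)) (y + - z)"
      using N_add[OF yz] by (simp add: inner_add_left inner_add_right inner_diff_left inner_diff_right)
    also have "\<dots> \<le> e * (norm (y + z))\<^sup>2 + e * (norm (y + - z))\<^sup>2"
      using q(1)[of "y + z"] q(1)[of "y + - z"] yz m A by (simp add: E_linear)
    also have "\<dots> = 2 * (e * ((norm y)\<^sup>2 + (norm z)\<^sup>2))"
      by (simp add: power2_norm_eq_inner inner_add_left inner_add_right inner_diff_left inner_diff_right algebra_simps)
    finally show ?thesis by simp
  qed
  have **: "inner (N y) z - inner (N z) y \<le> e * ((norm y)\<^sup>2 + (norm z)\<^sup>2)"
    if yz: "E A y = y" "E A z = z" for y z
  proof -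
    \<comment> \<open>This choice gives \<open>imul w = z\<close>, so polarizing the imaginary part
      of the form in \<open>y\<close> and \<open>w\<close> yields the antisymmetric part in
      \<open>y\<close> and \<open>z\<close>.\<close>
    define w where "w = - imul z"
    have w: "E A w = w" "imul w = z" "norm w = norm z"
      using yz A by (simp_all add: w_def E_linear imul_minus imul_imul)
    have m: "E A (- w) = - w" using w A by (simp add: E_linear)
    have "N (y + - w) = N y - N w"
      using N_add[OF yz(1) m] N_scaleR[OF w(1) w(1), of "-1"] by simp
    then have "2 * (inner (N y) (imul w) + inner (N w) (imul y))
        = inner (N (y + w)) (imul (y + w)) - inner (N (y + - w)) (imul (y + - w))"
      using N_add[OF yz(1) w(1)]
      by (simp add: imul_add imul_diff imul_minus inner_add_left inner_add_right inner_diff_left inner_diff_right)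
    also have "\<dots> \<le> e * (norm (y + w))\<^sup>2 + e * (norm (y + - w))\<^sup>2"
      using q(2)[of "y + w"] q(2)[of "y + - w"] yz w m A by (simp add: E_linear)
    also have "\<dots> = 2 * (e * ((norm y)\<^sup>2 + (norm w)\<^sup>2))"
      by (simp add: power2_norm_eq_inner inner_add_left inner_add_right inner_diff_left inner_diff_right algebra_simps)
    finally have "inner (N y) z + inner (N w) (imul y) \<le> e * ((norm y)\<^sup>2 + (norm z)\<^sup>2)"
      by (simp add: w)
    moreover have "inner (N w) (imul y) = - inner (N z) y"
      using N_imul[OF w(1) w(1)] inner_imul_left[of "N w" y] by (simp add: w)
    ultimately show ?thesis by simp
  qed
  \<comment> \<open>Testing with \<open>z = s N x\<close> gives
    \<open>s |N x|^2 <= e |x|^2 + e s^2 |N x|^2\<close>; this \<open>s\<close> maximizes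
    \<open>s - e s^2\<close> and so gives the best bound.\<close>
  define s where "s = 1 / (2 * e)"
  have Nx: "E A (N x) = N x"
    using E_T_commute[OF A D[OF x]] x A by (simp add: N_def E_linear bop_cscale bop_E)
  then have sNx: "E A (s *\<^sub>R N x) = s *\<^sub>R N x" using A by (simp add: E_linear)
  have "inner (N x) (s *\<^sub>R N x) \<le> e * ((norm x)\<^sup>2 + (norm (s *\<^sub>R N x))\<^sup>2)"
    using *[OF x sNx] **[OF x sNx] by simp
  then have "s * (norm (N x))\<^sup>2 \<le> e * (norm x)\<^sup>2 + e * s\<^sup>2 * (norm (N x))\<^sup>2"
    unfolding inner_scaleR_right norm_scaleR power_mult_distrib power2_abs power2_norm_eq_inner
    by (simp add: distrib_left mult.assoc)
  then have "(norm (N x))\<^sup>2 \<le> (2 * e * norm x)\<^sup>2"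
    using e by (simp add: s_def field_simps power2_eq_square)
  then show ?thesis unfolding N_def
    by (rule power2_le_imp_le) (use e in simp)
qed

end

section \<open>Spectral projections of the exponential\<close>

lemma norm_diff_cis_sq:
  assumes "cmod w = 1"
  shows "(cmod (cis t - w))\<^sup>2 = 2 - 2 * Re (cnj w * cis t)"
proof -
  have "(Re w)\<^sup>2 + (Im w)\<^sup>2 = 1" using cmod_power2[of w] assms by simp
  then show ?thesis
    unfolding cmod_power2 by (simp add: power2_diff sin_squared_eq)
qed

lemma norm_cis_diff_le: "cmod (cis s - cis t) \<le> \<bar>s - t\<bar>"
proof -
  define u where "u = (s - t) / 2"
  then have st: "s - t = 2 * u" by simp
  have "(cmod (cis s - cis t))\<^sup>2 = 2 - 2 * cos (s - t)"
    by (subst norm_diff_cis_sq) (simp_all add: cos_diff mult.commute)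
  also have "\<dots> = (2 * sin u)\<^sup>2"
    unfolding st cos_double_sin by (simp add: power_mult_distrib)
  also have "\<dots> \<le> (s - t)\<^sup>2"
    using abs_sin_x_le_abs_x[of u] by (subst abs_le_square_iff[symmetric]) (simp add: st)
  finally show ?thesis using abs_le_square_iff[of "cmod (cis s - cis t)"] by simp
qed

text \<open>Exchanges distance from \<open>w\<close> for distance from \<open>- w\<close>: far from
  one means near the other.\<close>

lemma norm_cis_parallelogram: "cmod w = 1 \<Longrightarrow> (cmod (cis t + w))\<^sup>2 = 4 - (cmod (cis t - w))\<^sup>2"
  using norm_diff_cis_sq[of "- w" t] norm_diff_cis_sq[of w t] by simp

lemma cis_measurable [measurable]: "cis \<in> borel_measurable borel"
  by (intro borel_measurable_continuous_onI continuous_intros)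

locale exponential_resolution = spectral_resolution E
  for E :: "real set \<Rightarrow> 'a::chilbert \<Rightarrow> 'a" +
  fixes U :: "'a \<Rightarrow> 'a"
  assumes U: "spectral_integral E cis U"

sublocale exponential_resolution \<subseteq> spectral_operator E UNIV U cis
proof unfold_locales
  have "bop U" using U by (simp add: spectral_integral_def)
  then show "U (x + y) = U x + U y" "U (r *\<^sub>R x) = r *\<^sub>R U x" "U (imul x) = imul (U x)" for x y r
    by (simp_all add: bop_add bop_scaleR bop_imul)
  show "integrable (mu E x) cis" for x
  proof -
    interpret finite_measure "mu E x" by (rule finite_measure_mu)
    show ?thesis by (rule integrable_const_bound[where B = 1]) auto
  qed
  show "cinner (U x) x = integral\<^sup>L (mu E x) cis" for x
    using U by (simp add: spectral_integral_def)
qed auto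

context exponential_resolution
begin

lemmas E_U = E_T_commute[OF _ UNIV_I]

text \<open>The real line is cut into slices of width \<open>e\<close>, enumerated by
  \<open>int_decode\<close>. On each slice \<open>U\<close> is within \<open>2 * e\<close> of a
  scalar of modulus one, and the squared norms add up because \<open>U\<close> commutes with the
  orthogonal slice projections.\<close>

lemma norm_U_bounds:
  fixes e :: real and x :: 'a
  assumes e: "0 < e"
  shows "norm (U x) \<le> (1 + 2 * e) * norm x" "2 * e \<le> 1 \<Longrightarrow> (1 - 2 * e) * norm x \<le> norm (U x)"
proof -
  define A where "A n = {t :: real. \<lfloor>t / e\<rfloor> = int_decode n}" for n
  have A: "range A \<subseteq> sets borel" unfolding A_def by auto
  have disj: "disjoint_family A"
    unfolding A_def disjoint_family_on_def using inj_eq[OF inj_int_decode] by auto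
  have UN: "\<Union>(range A) = UNIV"
    unfolding A_def using surj_int_decode by (auto simp: surj_def)
  have sums: "(\<lambda>k. (norm (E (A k) y))\<^sup>2) sums (norm y)\<^sup>2" for y
    using norm_E_sums[OF A disj, of y] by (simp add: UN)
  have small: "norm (U y - cscale (cis (int_decode n * e)) y) \<le> 2 * e * norm y" if "E (A n) y = y" for n y
  proof (rule norm_bound[OF _ _ that _ e])
    fix t assume "t \<in> A n"
    then have "int_decode n \<le> t / e" "t / e < int_decode n + 1"
      unfolding A_def by (auto simp: floor_eq_iff)
    then have "\<bar>t - int_decode n * e\<bar> \<le> e" using e by (simp add: field_simps)
    then show "cmod (cis t - cis (int_decode n * e)) \<le> e"
      using norm_cis_diff_le order_trans by blast
  qed (use A in auto)
  have near: "\<bar>norm (U y) - norm y\<bar> \<le> 2 * e * norm y" if "E (A n) y = y" for n y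
    using small[OF that] norm_triangle_ineq3[of "U y" "cscale (cis (int_decode n * e)) y"]
    by (simp add: norm_cscale)
  have piece: "E (A n) (U x) = U (E (A n) x)" "\<bar>norm (U (E (A n) x)) - norm (E (A n) x)\<bar> \<le> 2 * e * norm (E (A n) x)" for n
    using A by (auto intro!: E_U near E_idem)
  have "(norm (U x))\<^sup>2 \<le> ((1 + 2 * e) * norm x)\<^sup>2"
    unfolding power_mult_distrib
  proof (rule sums_le[OF _ sums sums_mult[OF sums]])
    fix n
    show "(norm (E (A n) (U x)))\<^sup>2 \<le> (1 + 2 * e)\<^sup>2 * (norm (E (A n) x))\<^sup>2"
      unfolding power_mult_distrib[symmetric] piece(1)
      using piece(2)[of n] by (intro power_mono) (auto simp: algebra_simps)
  qed
  then show "norm (U x) \<le> (1 + 2 * e) * norm x"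
    by (rule power2_le_imp_le) (use e in simp)
  assume e1: "2 * e \<le> 1"
  have "((1 - 2 * e) * norm x)\<^sup>2 \<le> (norm (U x))\<^sup>2"
    unfolding power_mult_distrib
  proof (rule sums_le[OF _ sums_mult[OF sums] sums])
    fix n
    show "(1 - 2 * e)\<^sup>2 * (norm (E (A n) x))\<^sup>2 \<le> (norm (E (A n) (U x)))\<^sup>2"
      unfolding power_mult_distrib[symmetric] piece(1)
      using piece(2)[of n] mult_right_mono[OF e1, of "norm (E (A n) x)"]
      by (intro power_mono) (auto simp: algebra_simps)
  qed
  then show "(1 - 2 * e) * norm x \<le> norm (U x)"
    by (rule power2_le_imp_le) simp
qed

lemma norm_U: "norm (U x) = norm x"
proof -
  have e: "eventually (\<lambda>e::real. 0 < e \<and> 2 * e \<le> 1) (at_right 0)"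
    by (rule eventually_at_rightI[of _ "1/2"]) auto
  have "((\<lambda>e::real. norm (U x)) \<longlongrightarrow> norm x) (at_right 0)"
  proof (rule tendsto_sandwich)
    show "eventually (\<lambda>e. (1 - 2 * e) * norm x \<le> norm (U x)) (at_right 0)"
      by (rule eventually_mono[OF e]) (simp add: norm_U_bounds)
    show "eventually (\<lambda>e. norm (U x) \<le> (1 + 2 * e) * norm x) (at_right 0)"
      by (rule eventually_mono[OF e]) (simp add: norm_U_bounds)
  qed (auto intro!: tendsto_eq_intros)
  then show ?thesis by (simp add: tendsto_const_iff)
qed

text \<open>Once \<open>U\<close> is known to be isometric, expanding the square involves only the
  form of \<open>U\<close>. The result is exact, whereas the factor 2 of \<open>norm_bound\<close>
  would spoil the comparison of growth rates.\<close>

lemma norm_U_diff_sq: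
  assumes w: "cmod w = 1"
  shows "(norm (U x - cscale w x))\<^sup>2 = (\<integral>t. (cmod (cis t - w))\<^sup>2 \<partial>mu E x)"
proof -
  interpret finite_measure "mu E x" by (rule finite_measure_mu)
  have [simp]: "integrable (mu E x) cis" by (rule f_integrable) simp
  have "(norm (U x - cscale w x))\<^sup>2 = (norm (U x))\<^sup>2 + (norm (cscale w x))\<^sup>2 - 2 * inner (U x) (cscale w x)"
    by (simp add: power2_norm_eq_inner inner_diff_left inner_diff_right inner_commute)
  also have "\<dots> = 2 * (norm x)\<^sup>2 - 2 * Re (cnj w * cinner (U x) x)"
    using w by (simp add: norm_U norm_cscale) (simp add: cscale_def cinner_def inner_add_right)
  also have "\<dots> = 2 * (norm x)\<^sup>2 - (\<integral>t. 2 * Re (cnj w * cis t) \<partial>mu E x)"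
    using integral_Re[of "mu E x" "\<lambda>t. cnj w * cis t"]
    by (simp only: form UNIV_I Bochner_Integration.integral_mult_right_zero) simp
  also have "\<dots> = (\<integral>t. 2 - 2 * Re (cnj w * cis t) \<partial>mu E x)"
    using integrable_Re[of "mu E x" "\<lambda>t. cnj w * cis t"]
    by (subst Bochner_Integration.integral_diff)
       (simp_all only: integrable_mult_right integrable_const \<open>integrable (mu E x) cis\<close>, simp add: measure_mu)
  finally show ?thesis by (simp only: norm_diff_cis_sq[OF w])
qed

lemma
  assumes w: "cmod w = 1" and A: "A \<in> sets borel" and x: "E A x = x" and r: "0 \<le> r"
  shows norm_U_diff_le: "(\<And>t. t \<in> A \<Longrightarrow> cmod (cis t - w) \<le> r) \<Longrightarrow> norm (U x - cscale w x) \<le> r * norm x"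
    and norm_U_diff_ge: "(\<And>t. t \<in> A \<Longrightarrow> r \<le> cmod (cis t - w)) \<Longrightarrow> r * norm x \<le> norm (U x - cscale w x)"
proof -
  interpret finite_measure "mu E x" by (rule finite_measure_mu)
  have int: "integrable (mu E x) (\<lambda>t. (cmod (cis t - w))\<^sup>2)"
  proof (rule integrable_const_bound[where B = 4])
    have "cmod (cis t - w) \<le> 2" for t
      using norm_triangle_ineq4[of "cis t" w] w by simp
    then have "(cmod (cis t - w))\<^sup>2 \<le> 2\<^sup>2" for t
      by (rule power_mono) simp
    then show "AE t in mu E x. norm ((cmod (cis t - w))\<^sup>2) \<le> 4" by simp
  qed measurable
  have const: "(\<integral>t. r\<^sup>2 \<partial>mu E x) = (r * norm x)\<^sup>2"
    by (simp add: measure_mu power_mult_distrib)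
  show "norm (U x - cscale w x) \<le> r * norm x" if "\<And>t. t \<in> A \<Longrightarrow> cmod (cis t - w) \<le> r"
  proof (rule power2_le_imp_le)
    show "(norm (U x - cscale w x))\<^sup>2 \<le> (r * norm x)\<^sup>2"
      unfolding norm_U_diff_sq[OF w] const[symmetric]
      by (rule integral_mono_AE) (use AE_mu_range[OF A x] that int in \<open>auto intro!: power_mono\<close>)
  qed (use r in simp)
  show "r * norm x \<le> norm (U x - cscale w x)" if "\<And>t. t \<in> A \<Longrightarrow> r \<le> cmod (cis t - w)"
  proof (rule power2_le_imp_le)
    show "(r * norm x)\<^sup>2 \<le> (norm (U x - cscale w x))\<^sup>2"
      unfolding norm_U_diff_sq[OF w] const[symmetric]
      by (rule integral_mono_AE) (use AE_mu_range[OF A x] that int r in \<open>auto intro!: power_mono\<close>)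
  qed simp
qed

text \<open>Vectors in the range of \<open>E A\<close> are recognised by the growth of \<open>(U - w)\<^sup>n x\<close>, and
  this growth is not increased by an operator commuting with \<open>U\<close>.\<close>

lemma E_commuting_separated:
  assumes Z: "bop Z" "\<And>x. Z (U x) = U (Z x)" and w: "cmod w = 1"
    and A: "A \<in> sets borel" "\<And>t. t \<in> A \<Longrightarrow> cmod (cis t - w) \<le> r"
    and B: "B \<in> sets borel" "\<And>t. t \<in> B \<Longrightarrow> s \<le> cmod (cis t - w)"
    and rs: "0 \<le> r" "r < s"
  shows "E B (Z (E A x)) = 0"
proof -
  define N where "N y = U y - cscale w y" for y
  define y where "y = E A x"
  have EN: "E S ((N ^^ n) v) = (N ^^ n) (E S v)" if "S \<in> sets borel" for S n v
    by (induction n) (use that in \<open>simp_all add: N_def E_linear E_U bop_cscale bop_E\<close>)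
  have ZN: "Z ((N ^^ n) v) = (N ^^ n) (Z v)" for n v
    by (induction n) (simp_all add: N_def bop_diff bop_cscale Z)
  have up: "norm ((N ^^ n) y) \<le> r ^ n * norm y" for n
  proof (induction n)
    case (Suc n)
    have "norm (N ((N ^^ n) y)) \<le> r * norm ((N ^^ n) y)"
      unfolding N_def[of "(N ^^ n) y"]
      by (rule norm_U_diff_le[OF w A(1)]) (use A rs in \<open>auto simp: EN y_def E_idem\<close>)
    also have "\<dots> \<le> r * (r ^ n * norm y)" by (rule mult_left_mono[OF Suc]) (use rs in simp)
    finally show ?case by (simp add: mult.assoc)
  qed simp
  have low: "s ^ n * norm (E B v) \<le> norm ((N ^^ n) (E B v))" for n v
  proof (induction n)
    case (Suc n)
    have "s * (s ^ n * norm (E B v)) \<le> s * norm ((N ^^ n) (E B v))"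
      by (rule mult_left_mono[OF Suc]) (use rs in simp)
    also have "\<dots> \<le> norm (N ((N ^^ n) (E B v)))"
      unfolding N_def[of "(N ^^ n) (E B v)"]
      by (rule norm_U_diff_ge[OF w B(1)]) (use B rs in \<open>auto simp: EN E_idem\<close>)
    finally show ?case by (simp add: mult.assoc)
  qed simp
  obtain K where K: "\<And>v. norm (Z v) \<le> norm v * K" "0 \<le> K"
    using bounded_linear.nonneg_bounded[OF bop_bounded_linear[OF Z(1)]] by blast
  \<comment> \<open>The part of \<open>Z y\<close> in the range of \<open>E B\<close> grows at least
    like \<open>s ^ n\<close>, while the growth \<open>r ^ n\<close> of \<open>y\<close> survives
    \<open>Z\<close>; as \<open>r < s\<close>, that part must vanish.\<close>
  have "norm (E B (Z y)) \<le> (r / s) ^ n * (norm y * K)" for n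
  proof -
    have "s ^ n * norm (E B (Z y)) \<le> norm (E B (Z ((N ^^ n) y)))"
      using low[of n "Z y"] by (simp add: ZN EN B)
    also have "\<dots> \<le> norm ((N ^^ n) y) * K"
      using norm_E_le[OF B(1)] K(1) order_trans by blast
    also have "\<dots> \<le> (r ^ n * norm y) * K"
      by (rule mult_right_mono[OF up K(2)])
    finally show ?thesis using rs by (simp add: power_divide field_simps)
  qed
  moreover have "(\<lambda>n. (r / s) ^ n * (norm y * K)) \<longlonglongrightarrow> 0 * (norm y * K)"
    using rs by (intro tendsto_mult LIMSEQ_power_zero tendsto_const) auto
  ultimately have "norm (E B (Z y)) \<le> 0"
    by (intro LIMSEQ_le_const) auto
  then show ?thesis by (simp add: y_def)
qed

text \<open>With \<open>A\<close> the arc and \<open>B m\<close> exhausting its complement, both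
  \<open>E (B m) Z E A\<close> and \<open>E A Z E (B m)\<close> vanish by separation. The first says
  that \<open>Z\<close> preserves the range of \<open>E A\<close>, the second that it preserves the
  complementary range.\<close>

lemma E_commuting_arc:
  assumes Z: "bop Z" "\<And>x. Z (U x) = U (Z x)" and w: "cmod w = 1"
  shows "Z (E {t. cmod (cis t - w) \<le> r} x) = E {t. cmod (cis t - w) \<le> r} (Z x)"
proof (cases "0 \<le> r")
  case False
  then have "{t. cmod (cis t - w) \<le> r} = {}"
    by (metis (no_types, lifting) Collect_empty_eq norm_ge_zero order_trans)
  then show ?thesis by (simp add: bop_zero Z)
next
  case True
  define A where "A = {t. cmod (cis t - w) \<le> r}"
  define B where "B m = {t. r + 1 / Suc m \<le> cmod (cis t - w)}" for m
  have A [measurable]: "A \<in> sets borel" and B [measurable]: "B m \<in> sets borel" for m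
    unfolding A_def B_def by measurable
  have inc: "incseq B"
    unfolding B_def incseq_def
    by (auto intro: order_trans[rotated] simp: frac_le)
  have UN: "\<Union>(range B) = - A"
  proof -
    have "(\<exists>m. r + 1 / Suc m \<le> c) \<longleftrightarrow> r < c" for c
    proof
      assume "r < c"
      then obtain m where "inverse (Suc m) < c - r" using reals_Archimedean[of "c - r"] by auto
      then show "\<exists>m. r + 1 / Suc m \<le> c" by (intro exI[of _ m]) (simp add: inverse_eq_divide)
    next
      assume "\<exists>m. r + 1 / Suc m \<le> c"
      then show "r < c" by (smt (verit) divide_pos_pos of_nat_0_less_iff zero_less_Suc)
    qed
    moreover have "t \<in> \<Union>(range B) \<longleftrightarrow> (\<exists>m. r + 1 / Suc m \<le> cmod (cis t - w))" for t
      unfolding B_def by blast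
    ultimately show ?thesis by (simp add: set_eq_iff A_def not_le)
  qed
  have AB: "E (B m) (Z (E A v)) = 0" for m v
    by (rule E_commuting_separated[OF Z w, where r = r and s = "r + 1 / Suc m"])
       (use True in \<open>auto simp: A_def B_def simp flip: of_nat_Suc\<close>)
  have BA: "E A (Z (E (B m) v)) = 0" for m v
  proof (cases "r + 1 / Suc m \<le> 2")
    case False
    have "cmod (cis t - w) \<le> 2" for t
      using norm_triangle_ineq4[of "cis t" w] w by simp
    then have "B m = {}" using False unfolding B_def by (auto intro: order_trans)
    then show ?thesis using A by (simp add: bop_zero Z E_linear)
  next
    case le2: True
    \<comment> \<open>Seen from \<open>- w\<close> near and far are exchanged: \<open>B m\<close>
      becomes the inner set and \<open>A\<close> the outer one, with radii given by the
      parallelogram identity.\<close>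
    show ?thesis
    proof (rule E_commuting_separated[OF Z, of "- w"])
      let ?s = "r + 1 / Suc m"
      have "r < ?s" by (simp flip: of_nat_Suc)
      then have "r\<^sup>2 < ?s\<^sup>2" using True by (simp add: power_strict_mono)
      moreover have "?s\<^sup>2 \<le> 2\<^sup>2" using True le2 by (intro power_mono) auto
      ultimately show "sqrt (4 - ?s\<^sup>2) < sqrt (4 - r\<^sup>2)" "0 \<le> sqrt (4 - ?s\<^sup>2)" by simp_all
      show "cmod (cis t - - w) \<le> sqrt (4 - ?s\<^sup>2)" if "t \<in> B m" for t
      proof -
        have "?s\<^sup>2 \<le> (cmod (cis t - w))\<^sup>2"
          using that True unfolding B_def by (intro power_mono) auto
        then show ?thesis by (intro real_le_rsqrt) (simp add: norm_cis_parallelogram[OF w])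
      qed
      show "sqrt (4 - r\<^sup>2) \<le> cmod (cis t - - w)" if "t \<in> A" for t
      proof -
        have "(cmod (cis t - w))\<^sup>2 \<le> r\<^sup>2"
          using that True unfolding A_def by (intro power_mono) auto
        then show ?thesis by (intro real_le_lsqrt) (simp_all add: norm_cis_parallelogram[OF w])
      qed
    qed (use w A B in auto)
  qed
  have lim: "(\<lambda>m. E (B m) v) \<longlonglongrightarrow> v - E A v" for v
    using E_incseq[of B v] inc B by (auto simp: UN E_Compl image_subset_iff)
  have "Z (E A x) - E A (Z (E A x)) = 0"
    using lim[of "Z (E A x)"] by (simp add: AB LIMSEQ_const_iff)
  moreover have "(\<lambda>m. E A (Z (E (B m) x))) \<longlonglongrightarrow> E A (Z (x - E A x))"
    by (intro bop_tendsto[OF bop_E] bop_tendsto[OF Z(1)] lim A)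
  then have "E A (Z x) = E A (Z (E A x))"
    using A by (simp add: BA LIMSEQ_const_iff bop_diff Z E_linear)
  ultimately show ?thesis unfolding A_def by simp
qed

text \<open>A closed subset of the circle is the intersection over \<open>n\<close> of the unions of
  arcs of radius \<open>1 / Suc n\<close> about a countable dense subset, so arcs and
  \<open>sigma_algebra_commutant\<close> suffice.\<close>

lemma E_commuting_closed:
  assumes Z: "bop Z" "\<And>x. Z (U x) = U (Z x)" and C: "closed C" "C \<subseteq> sphere 0 1"
  shows "Z (E (cis -` C) x) = E (cis -` C) (Z x)"
proof -
  let ?M = "{A \<in> sets borel. \<forall>x. Z (E A x) = E A (Z x)}"
  interpret M: sigma_algebra UNIV ?M by (rule sigma_algebra_commutant[OF Z(1)])
  obtain T where T: "countable T" "T \<subseteq> C" "C \<subseteq> closure T" by (rule separable)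
  have "cis -` C = (\<Inter>n. \<Union>w\<in>T. {t. cmod (cis t - w) \<le> 1 / Suc n})"
  proof (intro equalityI subsetI)
    fix t assume "t \<in> cis -` C"
    then have "cis t \<in> closure T" using T by auto
    then have "\<exists>w\<in>T. cmod (cis t - w) \<le> 1 / Suc n" for n
      unfolding closure_approachable
      by (metis dist_commute dist_norm less_imp_le of_nat_0_less_iff zero_less_Suc zero_less_divide_1_iff)
    then show "t \<in> (\<Inter>n. \<Union>w\<in>T. {t. cmod (cis t - w) \<le> 1 / Suc n})" by auto
  next
    fix t assume t: "t \<in> (\<Inter>n. \<Union>w\<in>T. {t. cmod (cis t - w) \<le> 1 / Suc n})"
    have "\<exists>w\<in>C. dist w (cis t) < e" if "0 < e" for e
    proof -
      obtain n where "1 / Suc n < e" using reals_Archimedean[OF \<open>0 < e\<close>] by (auto simp: field_simps)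
      moreover obtain w where "w \<in> T" "cmod (cis t - w) \<le> 1 / Suc n" using t by blast
      ultimately show ?thesis using T by (auto simp: dist_norm norm_minus_commute intro!: bexI[of _ w])
    qed
    then show "t \<in> cis -` C" using closed_approachable[OF C(1)] by auto
  qed
  moreover have "{t. cmod (cis t - w) \<le> 1 / Suc n} \<in> ?M" if "w \<in> T" for w n
    using E_commuting_arc[OF Z, of w] that T C by (auto simp del: of_nat_Suc)
  then have "(\<Inter>n. \<Union>w\<in>T. {t. cmod (cis t - w) \<le> 1 / Suc n}) \<in> ?M"
    by (intro M.countable_INT'' M.countable_UN'' T M.top) auto
  ultimately have "cis -` C \<in> ?M" by (simp only:)
  then show ?thesis by simp
qed

end

section \<open>Spectrum of the self-adjoint operator\<close>

text \<open>\<open>S\<close> is the inverse of \<open>1 - h R\<close>, found by Banach's fixed point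
  theorem since \<open>z + h R y\<close> contracts in \<open>y\<close> by one half. It serves to
  show that the resolvent set is open.\<close>

lemma bop_resolvent_Neumann:
  fixes R :: "'a::chilbert \<Rightarrow> 'a"
  assumes R: "bop R" and K: "\<And>x. norm (R x) \<le> norm x * K" and h: "\<bar>h\<bar> * K \<le> 1 / 2"
  obtains S where "bop S" "\<And>x. S x = x + h *\<^sub>R R (S x)" "\<And>x. S (x - h *\<^sub>R R x) = x"
proof -
  have hR: "norm (h *\<^sub>R R x) \<le> (1 / 2) * norm x" for x
  proof -
    have "norm (h *\<^sub>R R x) \<le> \<bar>h\<bar> * (norm x * K)" using K by (simp add: mult_left_mono)
    also have "\<dots> \<le> norm x * (1 / 2)"
      using mult_left_mono[OF h, of "norm x"] by (simp add: algebra_simps)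
    finally show ?thesis by simp
  qed
  have fix1: "\<exists>!y. z + h *\<^sub>R R y = y" for z
  proof (rule banach_fix_type[where c = "1 / 2"])
    show "\<forall>x y. dist (z + h *\<^sub>R R x) (z + h *\<^sub>R R y) \<le> 1 / 2 * dist x y"
    proof (intro allI)
      fix x y
      have "h *\<^sub>R R x - h *\<^sub>R R y = h *\<^sub>R R (x - y)" by (simp add: bop_diff R scaleR_diff_right)
      then show "dist (z + h *\<^sub>R R x) (z + h *\<^sub>R R y) \<le> 1 / 2 * dist x y"
        using hR[of "x - y"] by (simp add: dist_norm)
    qed
  qed auto
  define S where "S z = (THE y. z + h *\<^sub>R R y = y)" for z
  have S: "z + h *\<^sub>R R (S z) = S z" for z
    unfolding S_def by (rule theI'[OF fix1])
  have uniq: "z + h *\<^sub>R R y = y \<Longrightarrow> S z = y" for z y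
    using fix1[of z] S[of z] by blast
  have "bop S"
    unfolding bop_def
  proof (intro conjI allI bounded_linear_intro)
    show "S (x + y) = S x + S y" for x y
    proof (rule uniq)
      have "(x + h *\<^sub>R R (S x)) + (y + h *\<^sub>R R (S y)) = S x + S y" by (simp only: S)
      then show "x + y + h *\<^sub>R R (S x + S y) = S x + S y"
        by (simp add: bop_add R scaleR_add_right add_ac)
    qed
    show "S (r *\<^sub>R x) = r *\<^sub>R S x" for r x
    proof (rule uniq)
      have "r *\<^sub>R (x + h *\<^sub>R R (S x)) = r *\<^sub>R S x" by (simp only: S)
      then show "r *\<^sub>R x + h *\<^sub>R R (r *\<^sub>R S x) = r *\<^sub>R S x"
        by (simp add: bop_scaleR R scaleR_add_right mult.commute)
    qed
    show "S (imul x) = imul (S x)" for x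
      by (rule uniq) (simp add: bop_imul R S flip: imul_scaleR imul_add)
    show "norm (S x) \<le> norm x * 2" for x
      using norm_triangle_ineq[of x "h *\<^sub>R R (S x)"] hR[of "S x"] S[of x] by simp
  qed
  moreover have "S (x - h *\<^sub>R R x) = x" for x by (rule uniq) simp
  ultimately show ?thesis using that[of S] S by metis
qed

locale self_adjoint_resolution =
  fixes E :: "real set \<Rightarrow> 'a::chilbert \<Rightarrow> 'a" and D :: "'a set" and X :: "'a \<Rightarrow> 'a"
  assumes sa: "self_adjoint D X" and EX: "spectral_measure_of E D X"

sublocale self_adjoint_resolution \<subseteq> spectral_resolution E
  using EX by unfold_locales (simp add: spectral_measure_of_def)

context self_adjoint_resolution
begin

lemma D_iff: "x \<in> D \<longleftrightarrow> integrable (mu E x) (\<lambda>t. t\<^sup>2)"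
  using EX by (simp add: spectral_measure_of_def)

lemma E_mem_D:
  assumes A [measurable]: "A \<in> sets borel" and "x \<in> D"
  shows "E A x \<in> D"
proof -
  have "integrable (mu E x) (\<lambda>t. indicator A t *\<^sub>R t\<^sup>2)"
    using assms by (intro integrable_mult_indicator) (auto simp: D_iff)
  then show ?thesis by (simp add: D_iff mu_E integrable_density)
qed

lemma integrable_id: "x \<in> D \<Longrightarrow> integrable (mu E x) (\<lambda>t. complex_of_real t)"
proof -
  assume "x \<in> D"
  interpret finite_measure "mu E x" by (rule finite_measure_mu)
  have le: "\<bar>t\<bar> \<le> \<bar>1 + t\<^sup>2\<bar>" for t :: real
    using zero_le_power2[of "\<bar>t\<bar> - 1"] by (simp add: power2_diff)
  show ?thesis
    by (rule Bochner_Integration.integrable_bound[where f = "\<lambda>t. 1 + t\<^sup>2"])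
       (use \<open>x \<in> D\<close> le in \<open>auto simp: D_iff\<close>)
qed

end

sublocale self_adjoint_resolution \<subseteq> spectral_operator E D X complex_of_real
proof unfold_locales
  have *: "(\<forall>c. \<forall>x\<in>D. cscale c x \<in> D) \<and> (\<forall>c. \<forall>x\<in>D. X (cscale c x) = cscale c (X x)) \<and>
      (\<forall>x\<in>D. \<forall>y\<in>D. x + y \<in> D) \<and> (\<forall>x\<in>D. \<forall>y\<in>D. X (x + y) = X x + X y) \<and> closure D = UNIV"
    using sa unfolding self_adjoint_def by (elim conjE) (intro conjI, assumption+)
  have scale: "cscale c x \<in> D" "X (cscale c x) = cscale c (X x)" if "x \<in> D" for c x
    using * that by blast+
  show "r *\<^sub>R x \<in> D" "X (r *\<^sub>R x) = r *\<^sub>R X x" "imul x \<in> D" "X (imul x) = imul (X x)" if "x \<in> D" for r x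
    using scale[OF that, of "of_real r"] scale[OF that, of \<i>] by (simp_all add: cscale_of_real cscale_i)
  show "closure D = UNIV" "\<And>x y. x \<in> D \<Longrightarrow> y \<in> D \<Longrightarrow> x + y \<in> D"
    "\<And>x y. x \<in> D \<Longrightarrow> y \<in> D \<Longrightarrow> X (x + y) = X x + X y"
    using * by blast+
  show "cinner (X x) x = integral\<^sup>L (mu E x) complex_of_real" if "x \<in> D" for x
    using EX that by (simp only: spectral_measure_of_def integral_complex_of_real)
qed (auto intro: E_mem_D integrable_id)

context self_adjoint_resolution
begin

lemma E_bounded_mem_D:
  assumes A: "A \<in> sets borel" "\<And>t. t \<in> A \<Longrightarrow> \<bar>t\<bar> \<le> K"
  shows "E A x \<in> D"
proof -
  interpret finite_measure "mu E (E A x)" by (rule finite_measure_mu)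
  have "AE t in mu E (E A x). norm (t\<^sup>2) \<le> K\<^sup>2"
    using AE_mu_range[OF A(1) E_idem[OF A(1)], of x]
  proof eventually_elim
    case (elim t)
    then show ?case using power_mono[OF A(2)[OF elim], of 2] by simp
  qed
  then show ?thesis unfolding D_iff by (rule integrable_const_bound) simp
qed

lemma norm_X_diff_le:
  assumes A: "A \<in> sets borel" "\<And>s. s \<in> A \<Longrightarrow> \<bar>s - t\<bar> \<le> e" and e: "0 < e" and x: "E A x = x"
  shows "x \<in> D" "norm (X x - t *\<^sub>R x) \<le> 2 * e * norm x"
proof -
  have ran: "E A y \<in> D" for y
    by (rule E_bounded_mem_D[where K = "\<bar>t\<bar> + e"]) (use A in force)+
  show "x \<in> D" using ran[of x] x by simp
  show "norm (X x - t *\<^sub>R x) \<le> 2 * e * norm x"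
    using norm_bound[OF A(1) ran x _ e, of "of_real t"] A(2)
    by (simp add: cscale_of_real flip: of_real_diff)
qed

text \<open>Nonzero vectors in the range of \<open>E {t}\<close> are eigenvectors:
  \<open>{t}\<close> satisfies \<open>norm_X_diff_le\<close> for every positive \<open>e\<close>, so
  \<open>X - t\<close> vanishes there.\<close>

lemma E_singleton_eq_zero:
  assumes "t \<notin> point_spectrum D X"
  shows "E {t} x = 0"
proof (rule ccontr)
  assume ne: "E {t} x \<noteq> 0"
  have *: "E {t} x \<in> D" "norm (X (E {t} x) - t *\<^sub>R E {t} x) \<le> 2 * e * norm (E {t} x)" if "0 < e" for e
    by (rule norm_X_diff_le[of "{t}" t e]; use that in \<open>simp add: E_idem\<close>)+
  have "norm (X (E {t} x) - t *\<^sub>R E {t} x) \<le> 0"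
  proof (rule field_le_epsilon)
    fix e :: real assume "0 < e"
    then show "norm (X (E {t} x) - t *\<^sub>R E {t} x) \<le> 0 + e"
      using *(2)[of "e / (2 * norm (E {t} x))"] ne by simp
  qed
  then show False using assms *(1)[of 1] ne by (auto simp: point_spectrum_def)
qed

lemma E_countable_eq_zero:
  assumes "countable B" "B \<inter> point_spectrum D X = {}"
  shows "E B x = 0"
proof -
  have "E (\<Union>b\<in>B. {b}) x = 0"
    using assms by (intro E_null_UN E_singleton_eq_zero) auto
  then show ?thesis by simp
qed

text \<open>On the spectral subspace of a short interval about \<open>t\<close> the operator
  \<open>X - t\<close> is small, while a bounded inverse keeps it bounded below.\<close>

lemma E_locally_null:
  assumes "t \<notin> uspectrum D X"
  obtains e where "0 < e" "\<And>x. E {t - e<..<t + e} x = 0"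
proof -
  obtain R where R: "bop R" "\<And>x. x \<in> D \<Longrightarrow> R (X x - t *\<^sub>R x) = x"
    using assms by (auto simp: uspectrum_def)
  obtain K where K: "0 < K" "\<And>x. norm (R x) \<le> norm x * K"
    using bounded_linear.pos_bounded[OF bop_bounded_linear[OF R(1)]] by blast
  \<comment> \<open>This half-width makes \<open>2 * e * K\<close> equal to one half, which leaves
    \<open>norm ?y <= norm ?y / 2\<close>.\<close>
  define e where "e = 1 / (4 * K)"
  have e: "0 < e" using K by (simp add: e_def)
  have "E {t - e<..<t + e} x = 0" for x
  proof -
    let ?y = "E {t - e<..<t + e} x"
    have y: "?y \<in> D" "norm (X ?y - t *\<^sub>R ?y) \<le> 2 * e * norm ?y"
      by (rule norm_X_diff_le[of "{t - e<..<t + e}" t e]; use e in \<open>auto simp: E_idem\<close>)+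
    have "norm ?y \<le> norm (X ?y - t *\<^sub>R ?y) * K" using K(2) R(2)[OF y(1)] by metis
    also have "\<dots> \<le> (2 * e * norm ?y) * K" by (rule mult_right_mono[OF y(2)]) (use K in simp)
    also have "\<dots> = norm ?y / 2" using K by (simp add: e_def)
    finally show ?thesis by simp
  qed
  with e that show ?thesis by blast
qed

lemma closed_uspectrum: "closed (uspectrum D X)"
  unfolding closed_def open_dist
proof (intro ballI)
  fix t assume "t \<in> - uspectrum D X"
  then obtain R where R: "bop R" "\<And>x. R x \<in> D" "\<And>x. X (R x) - t *\<^sub>R R x = x"
      "\<And>x. x \<in> D \<Longrightarrow> R (X x - t *\<^sub>R x) = x"
    by (auto simp: uspectrum_def)
  obtain K where K: "0 < K" "\<And>x. norm (R x) \<le> norm x * K"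
    using bounded_linear.pos_bounded[OF bop_bounded_linear[OF R(1)]] by blast
  \<comment> \<open>The resolvent at a nearby point is \<open>R\<close> after the inverse of
    \<open>1 - h R\<close>, where \<open>h = s - t\<close>.\<close>
  have "s \<notin> uspectrum D X" if s: "dist s t < 1 / (2 * K)" for s
  proof -
    define h where "h = s - t"
    have "\<bar>h\<bar> * K \<le> 1 / 2" using s K by (simp add: h_def dist_real_def field_simps)
    then obtain S where S: "bop S" "\<And>x. S x = x + h *\<^sub>R R (S x)" "\<And>x. S (x - h *\<^sub>R R x) = x"
      using bop_resolvent_Neumann[OF R(1) K(2)] by blast
    have sX: "X y - s *\<^sub>R y = (X y - t *\<^sub>R y) - h *\<^sub>R y" for y
      by (simp add: h_def algebra_simps)
    have "bop (\<lambda>x. R (S x))"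
      using R(1) S(1) bounded_linear_compose[of R S] by (simp add: bop_def)
    moreover have "X (R (S x)) - s *\<^sub>R R (S x) = x" for x
      unfolding sX R(3) by (subst (1) S(2)) simp
    moreover have "R (S (X x - s *\<^sub>R x)) = x" if "x \<in> D" for x
      using S(3)[of "X x - t *\<^sub>R x"] R(4)[OF that] by (simp add: sX)
    ultimately show ?thesis using R(2) unfolding uspectrum_def by blast
  qed
  then show "\<exists>e>0. \<forall>s. dist s t < e \<longrightarrow> s \<in> - uspectrum D X"
    using K by (intro exI[of _ "1 / (2 * K)"]) auto
qed

text \<open>The null neighbourhoods from \<open>E_locally_null\<close> may be uncountably many; the
  Lindelof property leaves countably many, whose union is null.\<close>

lemma E_Compl_uspectrum: "E (- uspectrum D X) x = 0"
proof -
  define F where "F = {I :: real set. open I \<and> (\<forall>x. E I x = 0)}"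
  obtain G where G: "G \<subseteq> F" "countable G" "\<Union>G = \<Union>F"
    using Lindelof[of F] by (auto simp: F_def)
  have "- uspectrum D X \<subseteq> \<Union>F"
  proof
    fix t assume "t \<in> - uspectrum D X"
    then obtain e where "0 < e" "\<And>x. E {t - e<..<t + e} x = 0" using E_locally_null by auto
    then show "t \<in> \<Union>F" by (intro UnionI[of "{t - e<..<t + e}"]) (auto simp: F_def)
  qed
  moreover have "E (\<Union>I\<in>G. I) y = 0" for y
    using G by (intro E_null_UN) (auto simp: F_def)
  ultimately show ?thesis
    using G closed_uspectrum by (intro E_null_mono[of "- uspectrum D X" "\<Union>F"]) (auto simp: F_def intro!: borel_open)
qed

end

text \<open>Turns the shifted operators in the definition of congruence-freeness into translates of
  the spectrum.\<close>

lemma uspectrum_shift: "uspectrum D (\<lambda>x. X x + c *\<^sub>R x) = (\<lambda>t. t + c) ` uspectrum D X"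
  for X :: "'a::chilbert \<Rightarrow> 'a"
proof -
  have "y + c *\<^sub>R z - t *\<^sub>R z = y - (t - c) *\<^sub>R z" for y z :: 'a and t
    by (simp add: scaleR_diff_left)
  then have *: "t \<in> uspectrum D (\<lambda>x. X x + c *\<^sub>R x) \<longleftrightarrow> t - c \<in> uspectrum D X" for t
    unfolding uspectrum_def by (simp only: mem_Collect_eq)
  show ?thesis
  proof (intro equalityI subsetI)
    fix t assume "t \<in> uspectrum D (\<lambda>x. X x + c *\<^sub>R x)"
    then show "t \<in> (\<lambda>t. t + c) ` uspectrum D X" by (intro image_eqI[of _ _ "t - c"]) (simp_all add: *)
  next
    fix t assume "t \<in> (\<lambda>t. t + c) ` uspectrum D X"
    then show "t \<in> uspectrum D (\<lambda>x. X x + c *\<^sub>R x)" by (auto simp: *)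
  qed
qed

lemma cis_eq_cis_iff: "cis s = cis t \<longleftrightarrow> (\<exists>k::int. s = t + 2 * of_int k * pi)"
proof -
  have "cis s = cis t \<longleftrightarrow> sin s = sin t \<and> cos s = cos t" by (auto simp: complex_eq_iff)
  then show ?thesis unfolding sin_cos_eq_iff by (simp add: mult_ac)
qed

lemma sets_borel_subset_sigma_algebra:
  assumes "sigma_algebra UNIV M" "\<And>a b :: real. {a..b} \<in> M"
  shows "sets borel \<subseteq> M"
proof -
  have "sets borel = sigma_sets UNIV (range (\<lambda>(a, b). {a..b :: real}))"
    by (subst borel_eq_atLeastAtMost) simp
  also have "\<dots> \<subseteq> M"
    by (rule sigma_algebra.sigma_sets_subset[OF assms(1)]) (use assms(2) in auto)
  finally show ?thesis .
qed

section \<open>Recovering the spectral projections of the self-adjoint operator from those of its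
  exponential\<close>

locale self_adjoint_exponential = self_adjoint_resolution E D X + exponential_resolution E U
  for E :: "real set \<Rightarrow> 'a::chilbert \<Rightarrow> 'a" and D X U
begin

text \<open>Saturating the spectral part \<open>?K\<close> of the interval under
  \<open>2 * pi\<close>-translations adds only points off the spectrum and spectral points congruent
  to a different spectral point; both kinds form null sets.\<close>

lemma E_interval_eq_closed_arc:
  assumes gcf: "gen_2pi_congruence_free E D X"
  shows "E {a..b} x = E (cis -` (cis ` ({a..b} \<inter> uspectrum D X))) x"
proof -
  let ?S = "uspectrum D X"
  let ?S' = "\<lambda>k::int. uspectrum D (\<lambda>x. X x + (2 * of_int k * pi) *\<^sub>R x)"
  let ?K = "{a..b} \<inter> ?S"
  let ?C = "cis -` (cis ` ?K)"
  have S [measurable]: "?S \<in> sets borel" using closed_uspectrum by auto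
  have S' [measurable]: "?S' k \<in> sets borel" for k
    unfolding uspectrum_shift add.commute[of _ "2 * of_int k * pi"]
    using closed_translation[OF closed_uspectrum] by (intro borel_closed)
  have "compact ?K" by (rule compact_Int_closed[OF compact_Icc closed_uspectrum])
  then have "closed (cis ` ?K)"
    by (intro compact_imp_closed compact_continuous_image continuous_intros)
  then have C [measurable]: "?C \<in> sets borel"
    by (intro borel_closed continuous_closed_vimage continuous_intros) auto
  define N where "N = (\<Union>k\<in>- {0}. ?S \<inter> ?S' k)"
  have N_null: "E N y = 0" for y
    unfolding N_def
  proof (rule E_null_UN)
    show "E (?S \<inter> ?S' k) y = 0" if "k \<in> - {0}" for k
      using gcf that by (simp add: gen_2pi_congruence_free_def)
  qed auto
  have [measurable]: "N \<in> sets borel" unfolding N_def by auto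
  have N_S: "E (N \<union> - ?S) y = 0" for y
  proof -
    have "E (- ?S - N) y = 0"
      by (rule E_null_mono[of _ "- ?S"]) (simp_all add: E_Compl_uspectrum)
    moreover have "E (N \<union> (- ?S - N)) y = E N y + E (- ?S - N) y"
      by (rule E_Un) auto
    ultimately show ?thesis by (simp add: Un_Diff_cancel N_null)
  qed
  \<comment> \<open>Applied to the saturation \<open>?C\<close> and to the interval itself, which
    differs from \<open>?K\<close> only off the spectrum.\<close>
  have drop_null: "E B x = E ?K x"
    if [measurable]: "B \<in> sets borel" and B: "?K \<subseteq> B" "B - ?K \<subseteq> N \<union> - ?S" for B
  proof -
    have "E (?K \<union> (B - ?K)) x = E ?K x + E (B - ?K) x"
      by (rule E_Un) auto
    moreover have "?K \<union> (B - ?K) = B" using B(1) by blast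
    moreover have "E (B - ?K) x = 0"
      by (rule E_null_mono[OF _ _ B(2) N_S]) auto
    ultimately show ?thesis by simp
  qed
  have "?C - ?K \<subseteq> N \<union> - ?S"
  proof
    fix t assume t: "t \<in> ?C - ?K"
    then obtain s where s: "s \<in> ?K" "cis t = cis s" by auto
    then obtain k :: int where k: "t = s + 2 * of_int k * pi" using cis_eq_cis_iff by auto
    with s t have "k \<noteq> 0" by auto
    then show "t \<in> N \<union> - ?S" using s k by (auto simp: N_def uspectrum_shift)
  qed
  then have "E ?C x = E ?K x"
    by (intro drop_null C) auto
  moreover have "E {a..b} x = E ?K x"
    by (rule drop_null) auto
  ultimately show ?thesis by simp
qed

lemma E_commuting:
  assumes gcf: "gen_2pi_congruence_free E D X" and Z: "bop Z" "\<And>x. Z (U x) = U (Z x)"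
    and A: "A \<in> sets borel"
  shows "Z (E A x) = E A (Z x)"
proof -
  have "sets borel \<subseteq> {A \<in> sets borel. \<forall>x. Z (E A x) = E A (Z x)}"
  proof (rule sets_borel_subset_sigma_algebra[OF sigma_algebra_commutant[OF Z(1)]])
    fix a b :: real
    have "compact (cis ` ({a..b} \<inter> uspectrum D X))"
      by (intro compact_continuous_image continuous_intros
          compact_Int_closed[OF compact_Icc closed_uspectrum])
    then have "closed (cis ` ({a..b} \<inter> uspectrum D X))" by (rule compact_imp_closed)
    then have "Z (E {a..b} x) = E {a..b} (Z x)" for x
      unfolding E_interval_eq_closed_arc[OF gcf] by (intro E_commuting_closed[OF Z]) auto
    then show "{a..b} \<in> {A \<in> sets borel. \<forall>x. Z (E A x) = E A (Z x)}" by simp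
  qed
  with A show ?thesis by blast
qed

end

section \<open>Exponentials of bounded operators\<close>

text \<open>The exponential in the library lives in a unital Banach algebra with \<open>norm 1 = 1\<close>. The extra
  real summand makes the operators form such an algebra even over the zero space.\<close>

typedef (overloaded) 'a endo = "UNIV :: (('a::banach \<times> real) \<Rightarrow>\<^sub>L ('a \<times> real)) set"
  morphisms apply_endo Endo by simp

setup_lifting type_definition_endo

instantiation endo :: (banach) real_normed_algebra_1
begin

lift_definition zero_endo :: "'a endo" is 0 .
lift_definition one_endo :: "'a endo" is "id_blinfun :: ('a \<times> real) \<Rightarrow>\<^sub>L ('a \<times> real)" .
lift_definition plus_endo :: "'a endo \<Rightarrow> 'a endo \<Rightarrow> 'a endo" is "(+)" .
lift_definition minus_endo :: "'a endo \<Rightarrow> 'a endo \<Rightarrow> 'a endo" is "(-)" .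
lift_definition uminus_endo :: "'a endo \<Rightarrow> 'a endo" is uminus .
lift_definition times_endo :: "'a endo \<Rightarrow> 'a endo \<Rightarrow> 'a endo" is "(o\<^sub>L)" .
lift_definition scaleR_endo :: "real \<Rightarrow> 'a endo \<Rightarrow> 'a endo" is scaleR .
lift_definition norm_endo :: "'a endo \<Rightarrow> real" is norm .
lift_definition dist_endo :: "'a endo \<Rightarrow> 'a endo \<Rightarrow> real" is dist .
lift_definition sgn_endo :: "'a endo \<Rightarrow> 'a endo" is sgn .
definition uniformity_endo :: "('a endo \<times> 'a endo) filter" where
  "uniformity_endo = (INF e\<in>{0<..}. principal {(x, y). dist x y < e})"
definition open_endo :: "'a endo set \<Rightarrow> bool" where
  "open_endo S = (\<forall>x\<in>S. \<forall>\<^sub>F (x', y) in uniformity. x' = x \<longrightarrow> y \<in> S)"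

instance
proof
  fix a b c :: "'a endo" and r s :: real and S :: "'a endo set"
  show "a + b + c = a + (b + c)" by transfer (rule add.assoc)
  show "a + b = b + a" by transfer (rule add.commute)
  show "0 + a = a" by transfer simp
  show "- a + a = 0" by transfer simp
  show "a - b = a + - b" by transfer simp
  show "a * b * c = a * (b * c)" by transfer (rule blinfun_eqI, simp)
  show "(a + b) * c = a * c + b * c" by transfer (rule blinfun_eqI, simp add: blinfun.bilinear_simps)
  show "a * (b + c) = a * b + a * c" by transfer (rule blinfun_eqI, simp add: blinfun.bilinear_simps)
  show "1 * a = a" by transfer (rule blinfun_eqI, simp)
  show "a * 1 = a" by transfer (rule blinfun_eqI, simp)
  show "r *\<^sub>R (a + b) = r *\<^sub>R a + r *\<^sub>R b" by transfer (rule scaleR_add_right)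
  show "(r + s) *\<^sub>R a = r *\<^sub>R a + s *\<^sub>R a" by transfer (rule scaleR_add_left)
  show "r *\<^sub>R s *\<^sub>R a = (r * s) *\<^sub>R a" by transfer simp
  show "1 *\<^sub>R a = a" by transfer simp
  show "r *\<^sub>R a * b = r *\<^sub>R (a * b)" by transfer (rule blinfun_eqI, simp add: blinfun.bilinear_simps)
  show "a * r *\<^sub>R b = r *\<^sub>R (a * b)" by transfer (rule blinfun_eqI, simp add: blinfun.bilinear_simps)
  show "dist a b = norm (a - b)" by transfer (rule dist_norm)
  show "sgn a = inverse (norm a) *\<^sub>R a" by transfer (rule sgn_div_norm)
  show "norm a = 0 \<longleftrightarrow> a = 0" by transfer simp
  show "norm (a + b) \<le> norm a + norm b" by transfer (rule norm_triangle_ineq)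
  show "norm (r *\<^sub>R a) = \<bar>r\<bar> * norm a" by transfer simp
  show "norm (a * b) \<le> norm a * norm b" by transfer (rule norm_blinfun_compose)
  have apply_one: "apply_endo (1 :: 'a endo) v = v" for v by transfer simp
  show norm_one: "norm (1 :: 'a endo) = 1"
  proof (rule antisym)
    show "norm (1 :: 'a endo) \<le> 1" by transfer (rule norm_blinfun_id_le)
    have "norm (apply_endo (1 :: 'a endo) (0, 1)) \<le> norm (apply_endo (1 :: 'a endo)) * norm (0 :: 'a, 1 :: real)"
      by (rule norm_blinfun)
    then show "1 \<le> norm (1 :: 'a endo)" by (simp add: apply_one norm_endo.rep_eq norm_prod_def)
  qed
  show "(0 :: 'a endo) \<noteq> 1"
  proof
    assume "(0 :: 'a endo) = 1"
    then have "apply_endo (1 :: 'a endo) (0, 1) = 0" by (metis blinfun.zero_left zero_endo.rep_eq)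
    then show False by (simp add: apply_one zero_prod_def)
  qed
  show "uniformity = (INF e\<in>{0<..}. principal {(x :: 'a endo, y). dist x y < e})"
    by (rule uniformity_endo_def)
  show "open S \<longleftrightarrow> (\<forall>x\<in>S. \<forall>\<^sub>F (x', y) in uniformity. x' = x \<longrightarrow> y \<in> S)"
    by (rule open_endo_def)
qed

end

instance endo :: (banach) banach
proof
  fix S :: "nat \<Rightarrow> 'a endo"
  assume "Cauchy S"
  then have "Cauchy (\<lambda>n. apply_endo (S n))" by (simp add: Cauchy_def dist_endo.rep_eq)
  then obtain L where "(\<lambda>n. apply_endo (S n)) \<longlonglongrightarrow> L"
    using Cauchy_convergent_iff convergent_def by blast
  then have "S \<longlonglongrightarrow> Endo L" by (simp add: tendsto_iff dist_endo.rep_eq Endo_inverse)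
  then show "convergent S" by (rule convergentI)
qed

text \<open>Annihilates the auxiliary real summand, so the exponential of \<open>extend T\<close>
  acts as \<open>op_exp T\<close> on the vectors \<open>(x, 0)\<close>.\<close>

definition extend :: "('a::banach \<Rightarrow> 'a) \<Rightarrow> 'a endo" where
  "extend T = Endo (Blinfun (\<lambda>v. (T (fst v), 0)))"

lemma apply_extend:
  assumes "bounded_linear T"
  shows "apply_endo (extend T) v = (T (fst v), 0)"
proof -
  have "bounded_linear (\<lambda>v :: 'a \<times> real. (T (fst v), 0 :: real))"
    by (intro bounded_linear_Pair bounded_linear_compose[OF assms bounded_linear_fst] bounded_linear_zero)
  then show ?thesis by (simp add: extend_def Endo_inverse bounded_linear_Blinfun_apply)
qed

lemma endo_eqI: "(\<And>v. apply_endo M v = apply_endo N v) \<Longrightarrow> M = N"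
  by (metis apply_endo_inject blinfun_eqI)

lemma bounded_linear_apply_endo: "bounded_linear (\<lambda>M. apply_endo M v)"
proof (rule bounded_linear_intro)
  show "norm (apply_endo M v) \<le> norm M * norm v" for M
    unfolding norm_endo.rep_eq by (rule norm_blinfun)
qed (simp_all add: plus_endo.rep_eq scaleR_endo.rep_eq blinfun.add_left blinfun.scaleR_left)

lemma apply_endo_mult: "apply_endo (M * N) v = apply_endo M (apply_endo N v)"
  by (simp add: times_endo.rep_eq)

lemma apply_endo_one: "apply_endo 1 v = v"
  by (simp add: one_endo.rep_eq)

lemma apply_extend_power:
  assumes "bounded_linear T"
  shows "apply_endo (extend T ^ n) (x, 0) = ((T ^^ n) x, 0)"
  by (induction n) (simp_all add: apply_endo_one apply_endo_mult apply_extend assms)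

lemma
  assumes T: "bounded_linear T"
  shows apply_exp_extend: "apply_endo (exp (extend T)) (x, 0) = (op_exp T x, 0)"
    and op_exp_sums: "(\<lambda>n. (1 / fact n) *\<^sub>R (T ^^ n) x) sums op_exp T x"
proof -
  have "(\<lambda>n. apply_endo (extend T ^ n /\<^sub>R fact n) (x, 0)) sums apply_endo (exp (extend T)) (x, 0)"
    by (rule bounded_linear.sums[OF bounded_linear_apply_endo exp_converges])
  then have *: "(\<lambda>n. ((1 / fact n) *\<^sub>R (T ^^ n) x, 0)) sums apply_endo (exp (extend T)) (x, 0)"
    by (simp add: scaleR_endo.rep_eq blinfun.scaleR_left apply_extend_power[OF T] inverse_eq_divide)
  have fst: "(\<lambda>n. (1 / fact n) *\<^sub>R (T ^^ n) x) sums fst (apply_endo (exp (extend T)) (x, 0))"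
    using bounded_linear.sums[OF bounded_linear_fst *] by simp
  have snd: "(\<lambda>n. 0) sums snd (apply_endo (exp (extend T)) (x, 0))"
    using bounded_linear.sums[OF bounded_linear_snd *] by simp
  show "apply_endo (exp (extend T)) (x, 0) = (op_exp T x, 0)"
    using sums_unique[OF fst] sums_unique[OF snd] by (simp add: op_exp_def prod_eq_iff)
  then show "(\<lambda>n. (1 / fact n) *\<^sub>R (T ^^ n) x) sums op_exp T x"
    using fst by simp
qed

lemma bounded_linear_op_exp:
  assumes "bounded_linear T"
  shows "bounded_linear (op_exp T)"
proof -
  have "bounded_linear (\<lambda>x. fst (apply_endo (exp (extend T)) (x, 0)))"
    by (intro bounded_linear_compose[OF bounded_linear_fst]
        bounded_linear_compose[OF blinfun.bounded_linear_right] bounded_linear_Pair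
        bounded_linear_ident bounded_linear_zero)
  then show ?thesis by (simp add: apply_exp_extend[OF assms])
qed

lemma op_exp_add:
  assumes A: "bounded_linear A" and B: "bounded_linear B" and comm: "\<And>x. A (B x) = B (A x)"
  shows "op_exp (\<lambda>x. A x + B x) x = op_exp A (op_exp B x)"
proof -
  have AB: "bounded_linear (\<lambda>x. A x + B x)" by (rule bounded_linear_add[OF A B])
  have "extend (\<lambda>x. A x + B x) = extend A + extend B"
    by (rule endo_eqI) (simp add: apply_extend A B AB plus_endo.rep_eq blinfun.add_left)
  moreover have "extend A * extend B = extend B * extend A"
    by (rule endo_eqI) (simp add: apply_endo_mult apply_extend A B comm)
  ultimately have "apply_endo (exp (extend (\<lambda>x. A x + B x))) (x, 0)
      = apply_endo (exp (extend A)) (apply_endo (exp (extend B)) (x, 0))"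
    by (simp add: exp_add_commuting apply_endo_mult)
  then show ?thesis by (simp add: apply_exp_extend A B AB)
qed

lemma op_exp_zero: "op_exp (\<lambda>x. 0) x = (x :: 'a::chilbert)"
proof -
  have "extend (\<lambda>x :: 'a. 0) = 0"
    by (rule endo_eqI) (simp add: apply_extend zero_endo.rep_eq zero_prod_def)
  then show ?thesis
    using apply_exp_extend[OF bounded_linear_zero, of x] by (simp add: apply_endo_one)
qed

lemma op_exp_commute:
  assumes T: "bounded_linear T" and Z: "bounded_linear Z" "\<And>x. Z (T x) = T (Z x)"
  shows "Z (op_exp T x) = op_exp T (Z x)"
proof (rule sums_unique2)
  have "Z ((T ^^ n) x) = (T ^^ n) (Z x)" for n by (induction n) (simp_all add: Z)
  then show "(\<lambda>n. (1 / fact n) *\<^sub>R (T ^^ n) (Z x)) sums Z (op_exp T x)"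
    using bounded_linear.sums[OF Z(1) op_exp_sums[OF T, of x]]
    by (simp add: linear_simps[OF Z(1)])
qed (rule op_exp_sums[OF T])

lemma op_exp_adjoint:
  assumes T: "bounded_linear T" and S: "bounded_linear S" and adj: "\<And>x y. inner (T x) y = inner x (S y)"
  shows "inner (op_exp T x) y = inner x (op_exp S y)"
proof (rule sums_unique2)
  have "inner ((T ^^ n) x) y = inner x ((S ^^ n) y)" for n
    by (induction n arbitrary: x) (simp_all add: adj funpow_swap1)
  then show "(\<lambda>n. inner x ((1 / fact n) *\<^sub>R (S ^^ n) y)) sums inner (op_exp T x) y"
    using bounded_linear.sums[OF bounded_linear_inner_left op_exp_sums[OF T, of x], of y] by simp
qed (rule bounded_linear.sums[OF bounded_linear_inner_right op_exp_sums[OF S]])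

text \<open>The derivative at 0 of \<open>exp (t A)\<close>, sampled at
  \<open>t = 1 / 2 ^ n\<close>; it recovers an operator from the dyadic roots of its
  exponential.\<close>

lemma op_exp_dyadic_derivative:
  assumes T: "bounded_linear T"
  shows "(\<lambda>n. 2 ^ n *\<^sub>R (op_exp (\<lambda>x. (1 / 2 ^ n) *\<^sub>R T x) x - x)) \<longlonglongrightarrow> T x"
proof -
  let ?A = "extend T"
  have "((\<lambda>t. exp (t *\<^sub>R ?A)) has_derivative (\<lambda>h. h *\<^sub>R ?A)) (at 0)"
    using exp_scaleR_has_vector_derivative_right[of ?A 0 UNIV] by (simp add: has_vector_derivative_def)
  then have *: "((\<lambda>h. norm (exp (h *\<^sub>R ?A) - 1 - h *\<^sub>R ?A) / norm h) \<longlongrightarrow> 0) (at 0)"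
    by (simp add: has_derivative_at)
  have "(\<lambda>n. 1 / 2 ^ n :: real) \<longlonglongrightarrow> 0"
    using LIMSEQ_power_zero[of "1 / 2 :: real"] by (simp add: power_divide)
  then have "filterlim (\<lambda>n. 1 / 2 ^ n :: real) (at 0) sequentially"
    by (simp add: filterlim_at)
  from filterlim_compose[OF * this]
  have "(\<lambda>n. norm (exp ((1 / 2 ^ n) *\<^sub>R ?A) - 1 - (1 / 2 ^ n) *\<^sub>R ?A) / norm (1 / 2 ^ n :: real)) \<longlonglongrightarrow> 0" .
  moreover have "norm (exp ((1 / 2 ^ n) *\<^sub>R ?A) - 1 - (1 / 2 ^ n) *\<^sub>R ?A) / norm (1 / 2 ^ n :: real)
      = norm (2 ^ n *\<^sub>R (exp ((1 / 2 ^ n) *\<^sub>R ?A) - 1) - ?A)" for n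
  proof -
    have "2 ^ n *\<^sub>R (exp ((1 / 2 ^ n) *\<^sub>R ?A) - 1) - ?A
        = 2 ^ n *\<^sub>R (exp ((1 / 2 ^ n) *\<^sub>R ?A) - 1 - (1 / 2 ^ n) *\<^sub>R ?A)"
      by (simp add: scaleR_diff_right)
    then show ?thesis by (simp only: norm_scaleR) simp
  qed
  ultimately have "(\<lambda>n. 2 ^ n *\<^sub>R (exp ((1 / 2 ^ n) *\<^sub>R ?A) - 1)) \<longlonglongrightarrow> ?A"
    by (simp add: tendsto_norm_zero_iff LIM_zero_iff)
  then have "(\<lambda>n. apply_endo (2 ^ n *\<^sub>R (exp ((1 / 2 ^ n) *\<^sub>R ?A) - 1)) (x, 0)) \<longlonglongrightarrow> apply_endo ?A (x, 0)"
    by (rule bounded_linear.tendsto[OF bounded_linear_apply_endo])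
  moreover have "apply_endo (2 ^ n *\<^sub>R (exp ((1 / 2 ^ n) *\<^sub>R ?A) - 1)) (x, 0)
      = (2 ^ n *\<^sub>R (op_exp (\<lambda>x. (1 / 2 ^ n) *\<^sub>R T x) x - x), 0)" for n
  proof -
    have Tn: "bounded_linear (\<lambda>x. (1 / 2 ^ n) *\<^sub>R T x)"
      by (rule bounded_linear_compose[OF bounded_linear_scaleR_right T])
    have "extend (\<lambda>x. (1 / 2 ^ n) *\<^sub>R T x) = (1 / 2 ^ n) *\<^sub>R ?A"
      by (rule endo_eqI) (simp add: apply_extend T Tn scaleR_endo.rep_eq blinfun.scaleR_left)
    then have "apply_endo (exp ((1 / 2 ^ n) *\<^sub>R ?A)) (x, 0) = (op_exp (\<lambda>x. (1 / 2 ^ n) *\<^sub>R T x) x, 0)"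
      by (metis apply_exp_extend[OF Tn])
    then show ?thesis
      by (simp add: scaleR_endo.rep_eq minus_endo.rep_eq blinfun.scaleR_left blinfun.diff_left apply_endo_one)
  qed
  ultimately show ?thesis
    using tendsto_fst[of _ "apply_endo ?A (x, 0)"] by (fastforce simp: apply_extend T)
qed

section \<open>Skew-adjoint operators and their dyadic roots\<close>

lemma op_exp_halve:
  assumes T: "bounded_linear T"
  shows "op_exp (\<lambda>x. (c / 2 ^ n) *\<^sub>R T x) x
    = op_exp (\<lambda>x. (c / 2 ^ Suc n) *\<^sub>R T x) (op_exp (\<lambda>x. (c / 2 ^ Suc n) *\<^sub>R T x) x)"
proof -
  let ?H = "\<lambda>x. (c / 2 ^ Suc n) *\<^sub>R T x"
  have H: "bounded_linear ?H"
    by (rule bounded_linear_compose[OF bounded_linear_scaleR_right T])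
  have "(\<lambda>x. (c / 2 ^ n) *\<^sub>R T x) = (\<lambda>x. ?H x + ?H x)"
    by (rule ext) (simp flip: scaleR_add_left)
  then show ?thesis using op_exp_add[OF H H] by simp
qed

text \<open>By induction each root \<open>T n\<close> is the identity: if \<open>T n\<close> is,
  then \<open>y = T (Suc n) x - x\<close> satisfies \<open>T (Suc n) y = - y\<close>, whereas
  \<open>T (Suc n)\<close> is positive, being the square of the next self-adjoint root.
  Differentiation gives \<open>A = 0\<close>.\<close>

lemma self_adjoint_eq_zero_if_op_exp_eq_id:
  assumes A: "bounded_linear A" and sa: "\<And>x y. inner (A x) y = inner x (A y)"
    and id: "\<And>x. op_exp A x = x"
  shows "A x = 0"
proof -
  define T where "T n = op_exp (\<lambda>x. (1 / 2 ^ n) *\<^sub>R A x)" for n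
  have bl: "bounded_linear (\<lambda>x. (1 / 2 ^ n) *\<^sub>R A x)" for n
    by (rule bounded_linear_compose[OF bounded_linear_scaleR_right A])
  note T_linear = linear_simps[OF bounded_linear_op_exp[OF bl], folded T_def]
  have T_Suc: "T n x = T (Suc n) (T (Suc n) x)" for n x
    unfolding T_def by (rule op_exp_halve[OF A])
  have T_sa: "inner (T n x) y = inner x (T n y)" for n x y
    unfolding T_def by (rule op_exp_adjoint[OF bl bl]) (simp add: sa)
  have "T n x = x" for n x
  proof (induction n arbitrary: x)
    case 0
    show ?case by (simp add: T_def id)
  next
    case (Suc n)
    define y where "y = T (Suc n) x - x"
    have "T (Suc n) y = - y"
      using Suc[of x] T_Suc[of n x] by (simp add: y_def T_linear)
    moreover have "inner (T (Suc n) y) y = inner (T (Suc (Suc n)) y) (T (Suc (Suc n)) y)"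
      by (subst T_Suc) (rule T_sa)
    ultimately have "- inner y y \<ge> 0" by (metis inner_ge_zero inner_minus_left)
    then have "inner y y = 0" using inner_ge_zero[of y] by linarith
    then have "y = 0" by simp
    then show ?case by (simp add: y_def)
  qed
  then have "(\<lambda>n. 0) \<longlonglongrightarrow> A x"
    using op_exp_dyadic_derivative[OF A, of x] by (simp add: T_def)
  then show ?thesis by (simp add: LIMSEQ_const_iff)
qed

text \<open>Anticommutation reads \<open>2 s W = - ((V - s) W + W (V - s))\<close>. On the range of
  \<open>Q\<close> this bounds the operator norm of \<open>W Q\<close> by \<open>r / s < 1\<close>
  times itself.\<close>

lemma anticommuting_eq_zero:
  fixes V W Q :: "'a::real_normed_vector \<Rightarrow> 'a"
  assumes V: "bounded_linear V" and W: "bounded_linear W"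
    and Q: "bounded_linear Q" "\<And>x. Q (Q x) = Q x" "\<And>x. norm (Q x) \<le> norm x"
    and QV: "\<And>x. Q (V x) = V (Q x)" and QW: "\<And>x. Q (W x) = W (Q x)"
    and anti: "\<And>x. V (W x) = - W (V x)"
    and near: "\<And>x. norm (V (Q x) - s *\<^sub>R Q x) \<le> r * norm (Q x)" and rs: "0 \<le> r" "r < s"
  shows "W (Q x) = 0"
proof -
  have bl: "bounded_linear (\<lambda>x. W (Q x))" by (rule bounded_linear_compose[OF W Q(1)])
  define B where "B = onorm (\<lambda>x. W (Q x))"
  have B: "norm (W (Q x)) \<le> B * norm x" and B0: "0 \<le> B" for x
    unfolding B_def by (rule onorm[OF bl], rule onorm_pos_le[OF bl])
  have "norm (W (Q x)) \<le> (r / s * B) * norm x" for x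
  proof -
    define y where "y = V (Q x) - s *\<^sub>R Q x"
    have Qy: "Q y = y" by (simp add: y_def linear_simps[OF Q(1)] QV Q(2))
    have "(2 * s) *\<^sub>R W (Q x) = - ((V (W (Q x)) - s *\<^sub>R W (Q x)) + W y)"
      by (simp add: y_def anti linear_simps[OF W] scaleR_2 flip: scaleR_scaleR)
    also have "norm \<dots> \<le> norm (V (W (Q x)) - s *\<^sub>R W (Q x)) + norm (W y)"
      unfolding norm_minus_cancel by (rule norm_triangle_ineq)
    also have "norm (V (W (Q x)) - s *\<^sub>R W (Q x)) \<le> r * norm (W (Q x))"
      using near[of "W x"] by (simp add: QW)
    also have "\<dots> \<le> r * (B * norm x)" using B rs by (intro mult_left_mono)
    also have "norm (W y) \<le> B * (r * norm x)"
    proof -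
      have "norm y \<le> r * norm x"
        using near[of x] mult_left_mono[OF Q(3)[of x] rs(1)] unfolding y_def by linarith
      then have "B * norm y \<le> B * (r * norm x)" using B0 by (rule mult_left_mono)
      with B[of y] Qy show ?thesis by simp
    qed
    finally have "2 * s * norm (W (Q x)) \<le> 2 * (r * (B * norm x))" using rs by (simp add: algebra_simps)
    then show ?thesis using rs by (simp add: field_simps)
  qed
  then have "B \<le> r / s * B"
    unfolding B_def using rs B0[unfolded B_def] by (intro onorm_bound) auto
  then have "B * (s - r) \<le> 0" using rs by (simp add: field_simps)
  then have "B \<le> 0" using rs by (simp add: mult_le_0_iff)
  with B[of x] B0 show ?thesis by simp
qed

text \<open>As \<open>Z\<close> commutes with the square of \<open>V\<close>, the commutator
  \<open>W = V Z - Z V\<close> anticommutes with \<open>V\<close>. Coercivity places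
  \<open>V\<close>, on the range of \<open>Q\<close>, within some \<open>r < s\<close> of a positive
  scalar \<open>s\<close>.\<close>

lemma commute_square_root:
  fixes V Z Q :: "'a::real_inner \<Rightarrow> 'a"
  assumes V: "bounded_linear V" "\<And>x. norm (V x) = norm x" and Z: "bounded_linear Z" "\<And>x. Z (V (V x)) = V (V (Z x))"
    and Q: "bounded_linear Q" "\<And>x. Q (Q x) = Q x" "\<And>x. norm (Q x) \<le> norm x"
    and QV: "\<And>x. Q (V x) = V (Q x)" and QZ: "\<And>x. Q (Z x) = Z (Q x)"
    and c: "0 < c" "c \<le> 1" and coercive: "\<And>x. c * (norm (Q x))\<^sup>2 \<le> inner (V (Q x)) (Q x)"
  shows "V (Z (Q x)) = Z (V (Q x))"
proof -
  define W where "W x = V (Z x) - Z (V x)" for x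
  \<comment> \<open>For an isometry
    \<open>|V y - s y|^2 = (1 + s^2) |y|^2 - 2 s inner (V y) y\<close>. Coercivity and
    \<open>s = 1 / c\<close> bound this by \<open>(s^2 - 1) |y|^2\<close>, which gives a radius
    below \<open>s\<close>.\<close>
  define s where "s = 1 / c"
  define r where "r = sqrt (s\<^sup>2 - 1)"
  have s: "1 \<le> s" using c by (simp add: s_def)
  then have s2: "1 \<le> s\<^sup>2" by simp
  have "W (Q x) = 0"
  proof (rule anticommuting_eq_zero[OF V(1) _ Q QV])
    show "bounded_linear W" unfolding W_def
      by (intro bounded_linear_sub bounded_linear_compose[OF V(1) Z(1)] bounded_linear_compose[OF Z(1) V(1)])
    show "Q (W x) = W (Q x)" for x by (simp add: W_def linear_simps[OF Q(1)] QV QZ)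
    show "V (W x) = - W (V x)" for x by (simp add: W_def linear_simps[OF V(1)] Z(2))
    show "norm (V (Q x) - s *\<^sub>R Q x) \<le> r * norm (Q x)" for x
    proof (rule power2_le_imp_le)
      have "(norm (V (Q x) - s *\<^sub>R Q x))\<^sup>2 = (1 + s\<^sup>2) * (norm (Q x))\<^sup>2 - 2 * s * inner (V (Q x)) (Q x)"
      proof -
        have "(norm (V (Q x) - s *\<^sub>R Q x))\<^sup>2
            = (norm (V (Q x)))\<^sup>2 + s\<^sup>2 * (norm (Q x))\<^sup>2 - 2 * s * inner (V (Q x)) (Q x)"
          unfolding power2_norm_eq_inner
          by (simp add: inner_diff_left inner_diff_right inner_commute power2_eq_square[of s])
        then show ?thesis by (simp add: V(2) distrib_right)
      qed
      also have "\<dots> \<le> (1 + s\<^sup>2) * (norm (Q x))\<^sup>2 - 2 * s * (c * (norm (Q x))\<^sup>2)"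
        using mult_left_mono[OF coercive[of x], of "2 * s"] s by simp
      also have "\<dots> = (s\<^sup>2 - 1) * (norm (Q x))\<^sup>2" using c by (simp add: s_def algebra_simps)
      finally show "(norm (V (Q x) - s *\<^sub>R Q x))\<^sup>2 \<le> (r * norm (Q x))\<^sup>2"
        using s2 by (simp add: r_def power_mult_distrib)
    qed (use s2 in \<open>simp add: r_def\<close>)
    show "0 \<le> r" "r < s" using s s2 by (auto simp: r_def intro!: real_less_lsqrt)
  qed
  then show ?thesis by (simp add: W_def)
qed

locale skew_operator =
  fixes Y :: "'a::chilbert \<Rightarrow> 'a"
  assumes Y: "bounded_linear Y" and skew: "inner (Y x) y = - inner x (Y y)"
begin

text \<open>The \<open>2 ^ n\<close>-th root of \<open>op_exp Y\<close> singled out by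
  \<open>Y\<close>; its companion \<open>V'\<close> turns out to be both inverse and
  adjoint.\<close>

definition V :: "nat \<Rightarrow> 'a \<Rightarrow> 'a" where "V n = op_exp (\<lambda>x. (1 / 2 ^ n) *\<^sub>R Y x)"
definition V' :: "nat \<Rightarrow> 'a \<Rightarrow> 'a" where "V' n = op_exp (\<lambda>x. (- 1 / 2 ^ n) *\<^sub>R Y x)"

lemma bounded_linear_scaled: "bounded_linear (\<lambda>x. c *\<^sub>R Y x)"
  by (rule bounded_linear_compose[OF bounded_linear_scaleR_right Y])

lemma V_linear: "bounded_linear (V n)" and V'_linear: "bounded_linear (V' n)"
  unfolding V_def V'_def by (intro bounded_linear_op_exp bounded_linear_scaled)+

lemma V_0: "V 0 = op_exp Y"
  by (simp add: V_def)

lemma V_Suc: "V n x = V (Suc n) (V (Suc n) x)"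
  unfolding V_def by (rule op_exp_halve[OF Y])

lemma V_adjoint: "inner (V n x) y = inner x (V' n y)"
  unfolding V_def V'_def by (rule op_exp_adjoint[OF bounded_linear_scaled bounded_linear_scaled]) (simp add: skew)

lemma V'_V: "V' n (V n x) = x" and V_V': "V n (V' n x) = x"
  unfolding V_def V'_def
  by (subst op_exp_add[OF bounded_linear_scaled bounded_linear_scaled, symmetric];
      simp add: linear_simps[OF Y] op_exp_zero)+

lemma norm_V: "norm (V n x) = norm x"
  by (simp add: norm_eq_sqrt_inner V_adjoint V'_V)

lemma norm_V': "norm (V' n x) = norm x"
  using norm_V[of n "V' n x"] by (simp add: V_V')

lemma V_commute:
  assumes "bounded_linear Z" "\<And>x. Z (Y x) = Y (Z x)"
  shows "Z (V n x) = V n (Z x)" "Z (V' n x) = V' n (Z x)"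
  unfolding V_def V'_def
  by (rule op_exp_commute[OF bounded_linear_scaled assms(1)]; simp add: linear_simps[OF assms(1)] assms(2))+

lemma V_derivative: "(\<lambda>n. 2 ^ n *\<^sub>R (V n x - x)) \<longlonglongrightarrow> Y x"
  unfolding V_def by (rule op_exp_dyadic_derivative[OF Y])

lemma commute_if_commute_V:
  assumes Z: "bounded_linear Z" and VZ: "\<And>n. n \<ge> N \<Longrightarrow> V n (Z x) = Z (V n x)"
  shows "Y (Z x) = Z (Y x)"
proof (rule LIMSEQ_unique)
  show "(\<lambda>n. Z (2 ^ n *\<^sub>R (V n x - x))) \<longlonglongrightarrow> Z (Y x)"
    by (rule bounded_linear.tendsto[OF Z V_derivative])
  have "\<forall>\<^sub>F n in sequentially. 2 ^ n *\<^sub>R (V n (Z x) - Z x) = Z (2 ^ n *\<^sub>R (V n x - x))"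
    by (rule eventually_sequentiallyI[of N]) (simp add: VZ linear_simps[OF Z])
  with V_derivative[of "Z x"] show "(\<lambda>n. Z (2 ^ n *\<^sub>R (V n x - x))) \<longlonglongrightarrow> Y (Z x)"
    by (rule Lim_transform_eventually)
qed

text \<open>A chord of level \<open>n\<close> is the sum of two chords of level \<open>n + 1\<close>
  of equal length. Hence \<open>2 ^ n * norm (V n x - x)\<close> increases with \<open>n\<close>,
  and its limit is \<open>norm (Y x)\<close>.\<close>

lemma norm_V_diff: "norm (V n x - x) \<le> norm (Y x) / 2 ^ n"
proof -
  define a where "a n = norm (2 ^ n *\<^sub>R (V n x - x))" for n
  have "incseq a"
  proof (rule incseq_SucI)
    fix n
    let ?d = "V (Suc n) x - x"
    have d: "V n x - x = V (Suc n) ?d + ?d"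
      by (subst V_Suc) (simp add: linear_simps[OF V_linear])
    have "norm (V n x - x) \<le> 2 * norm ?d"
      unfolding d using norm_triangle_ineq[of "V (Suc n) ?d" ?d] by (simp only: norm_V mult_2)
    then show "a n \<le> a (Suc n)" by (simp add: a_def)
  qed
  moreover have "a \<longlonglongrightarrow> norm (Y x)"
    unfolding a_def by (rule tendsto_norm[OF V_derivative])
  ultimately have "a n \<le> norm (Y x)" by (rule incseq_le)
  then have "2 ^ n * norm (V n x - x) \<le> norm (Y x)" by (simp only: a_def norm_scaleR) simp
  then show ?thesis by (simp add: pos_le_divide_eq mult.commute)
qed

lemma inner_V_ge: "(1 - (K / 2 ^ n)\<^sup>2 / 2) * (norm x)\<^sup>2 \<le> inner (V n x) x"
  if "\<And>x. norm (Y x) \<le> K * norm x"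
proof -
  have "norm (V n x - x) \<le> K / 2 ^ n * norm x"
    using norm_V_diff[of n x] divide_right_mono[OF that[of x], of "2 ^ n"] by simp
  then have "(norm (V n x - x))\<^sup>2 \<le> (K / 2 ^ n * norm x)\<^sup>2"
    by (rule power_mono) simp
  moreover have "(norm (V n x - x))\<^sup>2 = (norm (V n x))\<^sup>2 + (norm x)\<^sup>2 - 2 * inner (V n x) x"
    unfolding power2_norm_eq_inner by (simp add: inner_diff_left inner_diff_right inner_commute)
  then have "(norm (V n x - x))\<^sup>2 = 2 * (norm x)\<^sup>2 - 2 * inner (V n x) x"
    by (simp add: norm_V)
  ultimately show ?thesis by (simp only: power_mult_distrib left_diff_distrib)
qed

text \<open>The identity \<open>cos (2 t) = 2 (cos t)^2 - 1\<close> for numerical ranges. With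
  \<open>V\<close> of level \<open>Suc n\<close>, \<open>2 inner (V x) x\<close> is at most the norm
  of \<open>V x + V' x\<close>, whose square is \<open>2 + 2 inner (V (V x)) x\<close>.\<close>

lemma inner_V_double:
  assumes x: "norm x = 1" and a: "0 \<le> a" "a \<le> inner (V (Suc n) x) x"
  shows "2 * a\<^sup>2 - 1 \<le> inner (V n x) x"
proof -
  let ?v = "V (Suc n) x" and ?v' = "V' (Suc n) x"
  have n1: "inner x x = 1" using x by (simp flip: power2_norm_eq_inner)
  have n2: "inner ?v ?v = 1" "inner ?v' ?v' = 1" using x
    by (simp_all add: norm_V norm_V' flip: power2_norm_eq_inner)
  have "2 * inner ?v x = inner (?v + ?v') x"
    using V_adjoint[of "Suc n" x x] by (simp add: inner_add_left inner_add_right inner_commute)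
  also have "\<dots> \<le> norm (?v + ?v')"
    using norm_cauchy_schwarz[of "?v + ?v'" x] x by simp
  finally have "(2 * a)\<^sup>2 \<le> (norm (?v + ?v'))\<^sup>2" using a by (intro power_mono) auto
  also have "\<dots> = 2 + 2 * inner (V n x) x"
    using n2 V_adjoint[of "Suc n" ?v x]
    by (subst V_Suc) (simp add: power2_norm_eq_inner inner_add_left inner_add_right inner_commute)
  finally show ?thesis by (simp add: power_mult_distrib)
qed

lemma inner_V_cos:
  assumes x: "norm x = 1"
  shows "0 \<le> \<theta> \<Longrightarrow> 2 ^ j * \<theta> \<le> pi \<Longrightarrow> cos \<theta> \<le> inner (V (n + j) x) x \<Longrightarrow> cos (2 ^ j * \<theta>) \<le> inner (V n x) x"
proof (induction j arbitrary: \<theta>)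
  case (Suc j)
  \<comment> \<open>The bound \<pi> on the final angle keeps every earlier one at most \<pi>/2, so
    the cosine is nonnegative as \<open>inner_V_double\<close> demands.\<close>
  have "2 * \<theta> \<le> 2 ^ j * (2 * \<theta>)" using Suc.prems by (simp add: mult_le_cancel_right1)
  then have \<theta>: "\<theta> \<le> pi / 2" using Suc.prems by simp
  have "cos (2 * \<theta>) \<le> inner (V (n + j) x) x"
    unfolding cos_double_cos
    by (rule inner_V_double[OF x cos_ge_zero]) (use Suc.prems \<theta> in auto)
  then show ?case using Suc.IH[of "2 * \<theta>"] Suc.prems by (simp add: mult.assoc mult.left_commute)
qed simp

text \<open>A chord of length \<open>\<pi> / 2\<^sup>j\<^sup>+\<^sup>1\<close> of the unit circle subtends the angle \<open>2 arcsin (\<pi> / 2\<^sup>j\<^sup>+\<^sup>2)\<close>, and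
  \<open>2\<^sup>j\<close> times this angle tends to \<open>\<pi> / 2\<close>.\<close>

lemma inner_V_1_nonneg:
  assumes Y_le: "\<And>x. norm (Y x) \<le> pi * norm x"
  shows "0 \<le> inner (V 1 x) x"
proof -
  have unit: "0 \<le> inner (V 1 x) x" if x: "norm x = 1" for x
  proof -
    define \<theta> where "\<theta> j = 2 * arcsin (pi / 2 ^ (j + 2))" for j :: nat
    have small: "0 \<le> pi / 2 ^ (j + 2)" "pi / 2 ^ (j + 2) \<le> 1" for j :: nat
    proof -
      have "pi / 2 ^ (j + 2) \<le> pi / 4"
        by (intro divide_left_mono) (auto simp: mult_le_cancel_right1)
      then show "pi / 2 ^ (j + 2) \<le> 1" using pi_less_4 by linarith
    qed simp
    have lim: "(\<lambda>j. 2 ^ j * \<theta> j) \<longlonglongrightarrow> pi / 2"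
    proof -
      have "(\<lambda>j. pi / 2 ^ (j + 2)) \<longlonglongrightarrow> 0"
        using tendsto_mult[OF tendsto_const[of "pi / 4"] LIMSEQ_power_zero[of "1 / 2 :: real"]]
        by (simp add: power_divide)
      then have "filterlim (\<lambda>j. pi / 2 ^ (j + 2)) (at 0) sequentially"
        by (simp add: filterlim_at)
      moreover have "((\<lambda>h. arcsin h / h) \<longlongrightarrow> 1) (at 0)"
        using DERIV_arcsin[of 0] by (simp add: DERIV_def)
      ultimately have "(\<lambda>j. arcsin (pi / 2 ^ (j + 2)) / (pi / 2 ^ (j + 2))) \<longlonglongrightarrow> 1"
        by (rule filterlim_compose[rotated])
      from tendsto_mult[OF tendsto_const[of "pi / 2"] this] show ?thesis
        by (simp add: \<theta>_def field_simps power_add)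
    qed
    \<comment> \<open>The angles may exceed \<pi>/2, so the bound at a finite \<open>j\<close> may
      be negative. Being below \<pi> is enough for \<open>inner_V_cos\<close>; nonnegativity appears
      in the limit.\<close>
    have "\<forall>\<^sub>F j in sequentially. 2 ^ j * \<theta> j < pi"
      by (rule order_tendstoD(2)[OF lim]) simp
    then have "\<forall>\<^sub>F j in sequentially. cos (2 ^ j * \<theta> j) \<le> inner (V 1 x) x"
    proof eventually_elim
      case (elim j)
      have "cos (\<theta> j) = 1 - (pi / 2 ^ (1 + j))\<^sup>2 / 2"
        using small[of j] unfolding \<theta>_def cos_double_sin
        by (subst sin_arcsin) (auto simp: power_divide power_mult_distrib field_simps intro: order_trans[of _ 0])
      then have "cos (\<theta> j) \<le> inner (V (1 + j) x) x"
        using inner_V_ge[OF Y_le, of "1 + j" x] x by simp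
      moreover have "0 \<le> \<theta> j" unfolding \<theta>_def using small[of j] by (simp add: arcsin_nonneg)
      ultimately show ?case using inner_V_cos[OF x, of "\<theta> j" j 1] elim by simp
    qed
    moreover have "(\<lambda>j. cos (2 ^ j * \<theta> j)) \<longlonglongrightarrow> cos (pi / 2)"
      by (intro tendsto_cos lim)
    ultimately have "cos (pi / 2) \<le> inner (V 1 x) x"
      by (intro tendsto_upperbound) auto
    then show ?thesis by simp
  qed
  show ?thesis
  proof (cases "x = 0")
    case False
    have "0 \<le> inner (V 1 (x /\<^sub>R norm x)) (x /\<^sub>R norm x)" by (rule unit) (use False in simp)
    then show ?thesis using False by (simp add: linear_simps[OF V_linear] zero_le_mult_iff)
  qed simp
qed

text \<open>\<open>S = V 1 + V' 1\<close> is twice the real part of \<open>V 1\<close>. It lies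
  between 0 and 2, so \<open>S^2 <= 2 S\<close>, while \<open>S x\<close> equals
  \<open>op_exp Y + 1\<close> applied to \<open>V' 1 x\<close>, which \<open>gap\<close> bounds
  below.\<close>

lemma inner_V_1_coercive:
  assumes Y_le: "\<And>x. norm (Y x) \<le> pi * norm x" and d: "0 \<le> d"
    and gap: "d * norm (V' 1 x) \<le> norm (op_exp Y (V' 1 x) + V' 1 x)"
  shows "d\<^sup>2 / 4 * (norm x)\<^sup>2 \<le> inner (V 1 x) x"
proof -
  define S where "S x = V 1 x + V' 1 x" for x
  have S_sym: "inner (S y) z = inner y (S z)" for y z
    using V_adjoint[of 1 y z] V_adjoint[of 1 z y] by (simp add: S_def inner_add_left inner_add_right inner_commute)
  have S_form: "inner (S y) y = 2 * inner (V 1 y) y" for y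
    using V_adjoint[of 1 y y] by (simp add: S_def inner_add_left inner_add_right inner_commute)
  have S_le: "norm (S y) \<le> 2 * norm y" for y
    using norm_triangle_ineq[of "V 1 y" "V' 1 y"] by (simp add: S_def norm_V norm_V')
  have S_lin: "S (y - r *\<^sub>R z) = S y - r *\<^sub>R S z" for y z r
    by (simp add: S_def linear_simps[OF V_linear] linear_simps[OF V'_linear] scaleR_add_right)
  \<comment> \<open>Positivity at the vector \<open>x - S x / 2\<close> yields
    \<open>|S x|^2 <= 2 inner (S x) x\<close> without an operator square root.\<close>
  have "0 \<le> inner (S (x - (1/2) *\<^sub>R S x)) (x - (1/2) *\<^sub>R S x)"
    unfolding S_form using inner_V_1_nonneg[OF Y_le] by simp
  also have "\<dots> = inner (S x) x - (norm (S x))\<^sup>2 + inner (S (S x)) (S x) / 4"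
    using S_sym[of x "S x"] S_sym[of "S x" x]
    by (simp add: S_lin inner_diff_left inner_diff_right inner_commute power2_norm_eq_inner field_simps)
  also have "inner (S (S x)) (S x) \<le> 2 * (norm (S x))\<^sup>2"
    using norm_cauchy_schwarz[of "S (S x)" "S x"] mult_right_mono[OF S_le[of "S x"], of "norm (S x)"]
    by (simp add: power2_eq_square)
  finally have "(norm (S x))\<^sup>2 \<le> 4 * inner (V 1 x) x" by (simp add: S_form)
  moreover have "op_exp Y (V' 1 x) + V' 1 x = S x"
    using V_Suc[of 0 "V' 1 x"] by (simp add: S_def V_0 V_V')
  then have "d * norm x \<le> norm (S x)" using gap by (simp add: norm_V')
  then have "(d * norm x)\<^sup>2 \<le> (norm (S x))\<^sup>2" using d by (intro power_mono) auto
  ultimately show ?thesis by (simp add: power_mult_distrib)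
qed

end

section \<open>Logarithms of the unitary operator\<close>

text \<open>If the norm \<open>m\<close> of \<open>Y\<close> exceeded \<pi>, both \<open>i m\<close>
  and \<open>- i m\<close> would lie off the spectrum and \<open>Y^2 + m^2\<close> would be bounded
  below. Skewness, however, makes it small wherever \<open>norm (Y x)\<close> is close to
  \<open>m * norm x\<close>.\<close>

lemma norm_le_pi_if_bspectrum:
  assumes Y: "bop Y" and skew: "\<And>x y. inner (Y x) y = - inner x (Y y)"
    and spec: "bspectrum Y \<subseteq> {z. - pi \<le> Im z \<and> Im z \<le> pi}"
  shows "norm (Y x) \<le> pi * norm x"
proof -
  have bl: "bounded_linear Y" by (rule bop_bounded_linear[OF Y])
  define m where "m = onorm Y"
  have m: "norm (Y x) \<le> m * norm x" for x unfolding m_def by (rule onorm[OF bl])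
  have "m \<le> pi"
  proof (rule ccontr)
    assume "\<not> m \<le> pi"
    then have mpi: "pi < m" by simp
    then have m0: "0 < m" using pi_gt_zero by linarith
    have bound: "\<exists>K>0. \<forall>x. norm x \<le> norm (Y x - t *\<^sub>R imul x) * K" if "pi < \<bar>t\<bar>" for t
    proof -
      have "Complex 0 t \<notin> bspectrum Y" using spec that by (auto simp: abs_if split: if_splits)
      then obtain R where R: "bop R" "\<And>x. R (Y x - cscale (Complex 0 t) x) = x"
        by (auto simp: bspectrum_def)
      obtain K where "0 < K" "\<And>x. norm (R x) \<le> norm x * K"
        using bounded_linear.pos_bounded[OF bop_bounded_linear[OF R(1)]] by blast
      with R(2) show ?thesis by (metis cscale_def complex.sel scaleR_zero_left add_0)
    qed
    obtain K1 K2 where K: "0 < K1" "\<And>x. norm x \<le> norm (Y x - m *\<^sub>R imul x) * K1"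
        "0 < K2" "\<And>x. norm x \<le> norm (Y x - (- m) *\<^sub>R imul x) * K2"
      using bound[of m] bound[of "- m"] mpi m0 by auto
    define C where "C = K1 * K2"
    have C: "0 < C" using K by (simp add: C_def)
    have inv: "norm x \<le> norm (Y (Y x) + m\<^sup>2 *\<^sub>R x) * C" for x
    proof -
      let ?w = "Y x - (- m) *\<^sub>R imul x"
      have "Y ?w - m *\<^sub>R imul ?w = Y (Y x) + m\<^sup>2 *\<^sub>R x"
        by (simp add: bop_add bop_scaleR bop_imul Y imul_add imul_scaleR imul_imul scaleR_add_right scaleR_diff_right power2_eq_square)
      then have "norm ?w \<le> norm (Y (Y x) + m\<^sup>2 *\<^sub>R x) * K1" using K(2)[of ?w] by simp
      from mult_right_mono[OF this less_imp_le[OF K(3)]] K(4)[of x] show ?thesis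
        by (simp only: C_def mult.assoc)
    qed
    \<comment> \<open>\<open>sqrt q\<close> will bound \<open>Y\<close> although it is smaller than
      the norm \<open>m\<close>; the maximum keeps it nonnegative.\<close>
    define q where "q = max 0 (m\<^sup>2 - 1 / (C * m)\<^sup>2)"
    have q: "q < m\<^sup>2" using m0 C by (simp add: q_def)
    have "norm (Y x) \<le> sqrt q * norm x" for x
    proof (rule power2_le_imp_le)
      have "(norm (Y (Y x) + m\<^sup>2 *\<^sub>R x))\<^sup>2 = (norm (Y (Y x)))\<^sup>2 + 2 * m\<^sup>2 * inner (Y (Y x)) x + (m\<^sup>2)\<^sup>2 * (norm x)\<^sup>2"
        unfolding power2_norm_eq_inner
        by (simp add: inner_add_left inner_add_right inner_commute power2_eq_square[of "m\<^sup>2"])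
      also have "inner (Y (Y x)) x = - (norm (Y x))\<^sup>2" by (simp add: skew power2_norm_eq_inner)
      also have "(norm (Y (Y x)))\<^sup>2 \<le> m\<^sup>2 * (norm (Y x))\<^sup>2"
        using power_mono[OF m[of "Y x"], of 2] by (simp add: power_mult_distrib)
      finally have "(norm (Y (Y x) + m\<^sup>2 *\<^sub>R x))\<^sup>2 \<le> m\<^sup>2 * (m\<^sup>2 * (norm x)\<^sup>2 - (norm (Y x))\<^sup>2)"
        by (simp add: power2_eq_square[of "m\<^sup>2"] right_diff_distrib)
      moreover have "(norm x)\<^sup>2 \<le> (norm (Y (Y x) + m\<^sup>2 *\<^sub>R x))\<^sup>2 * C\<^sup>2"
        using power_mono[OF inv[of x], of 2] by (simp add: power_mult_distrib)
      ultimately have "(norm x)\<^sup>2 \<le> m\<^sup>2 * (m\<^sup>2 * (norm x)\<^sup>2 - (norm (Y x))\<^sup>2) * C\<^sup>2"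
        using C by (smt (verit) mult_right_mono zero_le_power2)
      then have "(norm x)\<^sup>2 \<le> (C * m)\<^sup>2 * (m\<^sup>2 * (norm x)\<^sup>2 - (norm (Y x))\<^sup>2)"
        by (simp add: power_mult_distrib mult_ac)
      then have "(norm x)\<^sup>2 / (C * m)\<^sup>2 \<le> m\<^sup>2 * (norm x)\<^sup>2 - (norm (Y x))\<^sup>2"
        using C m0 by (simp add: pos_divide_le_eq mult.commute)
      then have "(norm (Y x))\<^sup>2 \<le> (m\<^sup>2 - 1 / (C * m)\<^sup>2) * (norm x)\<^sup>2"
        by (simp add: left_diff_distrib)
      also have "\<dots> \<le> q * (norm x)\<^sup>2" by (rule mult_right_mono) (auto simp: q_def)
      finally show "(norm (Y x))\<^sup>2 \<le> (sqrt q * norm x)\<^sup>2" by (simp add: power_mult_distrib q_def)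
    qed (simp add: q_def)
    then have "m \<le> sqrt q" unfolding m_def by (intro onorm_bound) (auto simp: q_def)
    then have "m\<^sup>2 \<le> q" using m0 power_mono[of m "sqrt q" 2] by (simp add: q_def)
    with q show False by simp
  qed
  with m[of x] mult_right_mono[of m pi "norm x"] show ?thesis by simp
qed

lemma isometry_inner:
  fixes T :: "'a::real_inner \<Rightarrow> 'a"
  assumes T: "bounded_linear T" and iso: "\<And>x. norm (T x) = norm x"
  shows "inner (T x) (T y) = inner x y"
proof -
  have "(norm (T (x + y)))\<^sup>2 = (norm (x + y))\<^sup>2" "(norm (T x))\<^sup>2 = (norm x)\<^sup>2" "(norm (T y))\<^sup>2 = (norm y)\<^sup>2"
    by (simp_all only: iso)
  then show ?thesis
    unfolding power2_norm_eq_inner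
    by (simp add: linear_simps[OF T] inner_add_left inner_add_right inner_commute)
qed

text \<open>Normality lets \<open>op_exp_add\<close> split the exponential of the self-adjoint
  \<open>Ys + Y\<close> into \<open>op_exp Ys\<close> after \<open>op_exp Y\<close>, an adjoint
  times an isometry and hence the identity.\<close>

lemma normal_skew_if_op_exp_isometry:
  assumes normal: "normal_op Y" and iso: "\<And>x. norm (op_exp Y x) = norm x"
  shows "inner (Y x) y = - inner x (Y y)"
proof -
  obtain Ys where Y: "bop Y" and Ys: "bop Ys" "\<And>x y. cinner (Y x) y = cinner x (Ys y)"
      and comm: "\<And>x. Y (Ys x) = Ys (Y x)"
    using normal by (auto simp: normal_op_def adjoint_of_def fun_eq_iff)
  have adj: "inner (Y x) y = inner x (Ys y)" for x y
    using Ys(2)[of x y] by (simp add: cinner_def)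
  note bl = bop_bounded_linear[OF Y] bop_bounded_linear[OF Ys(1)]
  have "Ys x + Y x = 0" for x
  proof (rule self_adjoint_eq_zero_if_op_exp_eq_id[where A = "\<lambda>x. Ys x + Y x"])
    show "bounded_linear (\<lambda>x. Ys x + Y x)" by (intro bounded_linear_add bl)
    show "inner (Ys x + Y x) y = inner x (Ys y + Y y)" for x y
    proof -
      have "inner (Ys x) y = inner x (Y y)" using adj[of y x] by (simp add: inner_commute)
      then show ?thesis by (simp add: inner_add_left inner_add_right adj)
    qed
    show "op_exp (\<lambda>x. Ys x + Y x) x = x" for x
    proof -
      have "inner (op_exp Ys (op_exp Y x)) y = inner x y" for y
      proof -
        have "inner (op_exp Ys (op_exp Y x)) y = inner (op_exp Y x) (op_exp Y y)"
          by (rule op_exp_adjoint[OF bl(2,1)]) (metis adj inner_commute)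
        then show ?thesis
          by (simp add: isometry_inner[OF bounded_linear_op_exp[OF bl(1)] iso])
      qed
      then have "op_exp Ys (op_exp Y x) = x" by (metis inner_commute vector_eq_rdot)
      then show ?thesis by (simp add: op_exp_add bl comm)
    qed
  qed
  then have "Ys y = - Y y" by (metis add_eq_0_iff2)
  then show ?thesis by (simp add: adj)
qed

section \<open>Commutation away from the eigenvalue -1 of the unitary operator\<close>

locale skew_logarithm = exponential_resolution E "op_exp Y" + skew_operator Y
  for E :: "real set \<Rightarrow> 'a::chilbert \<Rightarrow> 'a" and Y +
  assumes bop_Y: "bop Y" and Y_le: "norm (Y x) \<le> pi * norm x"
begin

text \<open>Written as the preimage of a closed subset of the circle, the form that
  \<open>E_commuting_closed\<close> takes. The sets increase to the complement of the odd multiples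
  of \<pi>.\<close>

definition gap :: "nat \<Rightarrow> real set" where
  "gap n = cis -` (sphere 0 1 \<inter> {z. 1 / Suc n \<le> cmod (z + 1)})"

lemma gap_eq: "gap n = {t. 1 / Suc n \<le> cmod (cis t + 1)}"
  by (auto simp: gap_def)

lemma gap_measurable [measurable]: "gap n \<in> sets borel"
  unfolding gap_eq by measurable

lemma E_gap_commute:
  assumes "bop Z" "\<And>x. Z (op_exp Y x) = op_exp Y (Z x)"
  shows "Z (E (gap n) x) = E (gap n) (Z x)"
  unfolding gap_def
  by (intro E_commuting_closed[OF assms] closed_Int closed_sphere closed_Collect_le continuous_intros) auto

lemma Y_exp_commute: "Y (op_exp Y x) = op_exp Y (Y x)"
  by (rule op_exp_commute[OF Y Y]) simp

lemma E_gap_tendsto: "(\<lambda>n. E (gap n) x) \<longlonglongrightarrow> x - E (cis -` {-1}) x"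
proof -
  have "gap m \<subseteq> gap n" if "m \<le> n" for m n
  proof -
    have "1 / real (Suc n) \<le> 1 / real (Suc m)" using that by (intro divide_left_mono) auto
    then show ?thesis unfolding gap_eq by auto
  qed
  then have "incseq gap" by (simp add: incseq_def)
  moreover have "\<Union>(range gap) = - cis -` {-1}"
  proof -
    have "(\<exists>n. 1 / real (Suc n) \<le> cmod z) \<longleftrightarrow> z \<noteq> 0" for z :: complex
    proof
      assume "z \<noteq> 0"
      then obtain n where "inverse (real (Suc n)) < cmod z" using reals_Archimedean[of "cmod z"] by auto
      then show "\<exists>n. 1 / real (Suc n) \<le> cmod z" by (intro exI[of _ n]) (simp add: inverse_eq_divide)
    next
      assume "\<exists>n. 1 / real (Suc n) \<le> cmod z"
      then show "z \<noteq> 0" by (auto simp: not_le)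
    qed
    moreover have "t \<in> \<Union>(range gap) \<longleftrightarrow> (\<exists>n. 1 / real (Suc n) \<le> cmod (cis t + 1))" for t
      unfolding gap_eq by blast
    ultimately show ?thesis by (simp add: set_eq_iff eq_neg_iff_add_eq_0)
  qed
  moreover have "cis -` {-1} \<in> sets borel"
    by (rule measurable_sets_borel[OF cis_measurable]) simp
  ultimately show ?thesis
    using E_incseq[of gap x] by (auto simp: E_Compl image_subset_iff)
qed

text \<open>On the range of \<open>E (gap n)\<close> the operator \<open>op_exp Y + 1\<close> is
  bounded below by \<open>1 / Suc n\<close>, so \<open>inner_V_1_coercive\<close> supplies the
  coercivity for \<open>commute_square_root\<close>.\<close>

lemma commute_V_1_gap:
  assumes Z: "bop Z" "\<And>x. Z (op_exp Y x) = op_exp Y (Z x)"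
  shows "V 1 (Z (E (gap n) x)) = Z (V 1 (E (gap n) x))"
proof (rule commute_square_root[where Q = "E (gap n)" and c = "(1 / real (Suc n))\<^sup>2 / 4"])
  let ?Q = "E (gap n)" and ?d = "1 / real (Suc n)"
  have bop_Q: "bop ?Q" by (rule bop_E) measurable
  have Q_Y: "?Q (Y y) = Y (?Q y)" for y
    using E_gap_commute[OF bop_Y Y_exp_commute] by simp
  note Q_V = V_commute[OF bop_bounded_linear[OF bop_Q] Q_Y]
  show "bounded_linear (V 1)" by (rule V_linear)
  show "norm (V 1 x) = norm x" for x by (rule norm_V)
  show "bounded_linear Z" by (rule bop_bounded_linear[OF Z(1)])
  show "Z (V 1 (V 1 x)) = V 1 (V 1 (Z x))" for x
    using Z(2)[of x] V_Suc[of 0] by (simp add: V_0)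
  show "bounded_linear ?Q" by (rule bop_bounded_linear[OF bop_Q])
  show "?Q (?Q x) = ?Q x" "norm (?Q x) \<le> norm x" for x
    by (simp_all add: E_idem norm_E_le)
  show "?Q (V 1 x) = V 1 (?Q x)" for x by (rule Q_V)
  show "?Q (Z x) = Z (?Q x)" for x using E_gap_commute[OF Z] by simp
  show "0 < ?d\<^sup>2 / 4" by simp
  have "?d\<^sup>2 \<le> 1" by (intro power_le_one) auto
  then show "?d\<^sup>2 / 4 \<le> 1" by linarith
  show "?d\<^sup>2 / 4 * (norm (?Q x))\<^sup>2 \<le> inner (V 1 (?Q x)) (?Q x)" for x
  proof (rule inner_V_1_coercive[OF Y_le])
    have "E (gap n) (V' 1 (?Q x)) = V' 1 (?Q x)" by (simp add: Q_V(2) E_idem)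
    from norm_U_diff_ge[OF _ gap_measurable this, of "-1" ?d]
    show "?d * norm (V' 1 (?Q x)) \<le> norm (op_exp Y (V' 1 (?Q x)) + V' 1 (?Q x))"
      by (simp add: gap_eq cscale_def)
  qed simp
qed

text \<open>Only the first root uses the gaps, and the limit over them loses just the eigenspace for
  -1. Commutation then passes from each root to the next, and differentiation reaches
  \<open>Y\<close>.\<close>

lemma commute_off_minus_one:
  assumes Z: "bop Z" "\<And>x. Z (op_exp Y x) = op_exp Y (Z x)"
  shows "Y (Z (x - E (cis -` {-1}) x)) = Z (Y (x - E (cis -` {-1}) x))"
proof -
  let ?P = "E (cis -` {-1})"
  define Z' where "Z' y = Z (y - ?P y)" for y
  have P: "cis -` {-1} \<in> sets borel"
    by (rule measurable_sets_borel[OF cis_measurable]) simp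
  have bl: "bounded_linear Z'" unfolding Z'_def
    by (intro bounded_linear_compose[OF bop_bounded_linear[OF Z(1)]] bounded_linear_sub
        bounded_linear_ident bop_bounded_linear[OF bop_E[OF P]])
  have P_Y: "?P (Y y) = Y (?P y)" for y
    using E_commuting_closed[OF bop_Y Y_exp_commute, of "{-1}"] by simp
  note P_V = V_commute(1)[OF bop_bounded_linear[OF bop_E[OF P]] P_Y]
  have V1: "V 1 (Z' y) = Z' (V 1 y)" for y
  proof -
    have "(\<lambda>n. V 1 (Z (E (gap n) y))) \<longlonglongrightarrow> V 1 (Z' y)" unfolding Z'_def
      by (intro bounded_linear.tendsto[OF V_linear] bop_tendsto[OF Z(1)] E_gap_tendsto)
    moreover have "(\<lambda>n. Z (V 1 (E (gap n) y))) \<longlonglongrightarrow> Z (V 1 (y - ?P y))"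
      by (intro bounded_linear.tendsto[OF V_linear] bop_tendsto[OF Z(1)] E_gap_tendsto)
    ultimately have "V 1 (Z' y) = Z (V 1 (y - ?P y))"
      unfolding commute_V_1_gap[OF Z] by (rule LIMSEQ_unique)
    then show ?thesis by (simp add: Z'_def linear_simps[OF V_linear] P_V)
  qed
  have V_Z': "V (Suc n) (Z' y) = Z' (V (Suc n) y)" for n y
  proof (induction n arbitrary: y)
    case (Suc n)
    \<comment> \<open>From level 2 on \<open>pi / 2 ^ n\<close> is at most 1, so
      \<open>inner_V_ge\<close> gives coercivity 1/2 on the whole space and \<open>Q\<close> can be
      the identity.\<close>
    show ?case
    proof (rule commute_square_root[where Q = "\<lambda>x. x" and c = "1 / 2"])
      show "Z' (V (Suc (Suc n)) (V (Suc (Suc n)) x)) = V (Suc (Suc n)) (V (Suc (Suc n)) (Z' x))" for x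
        using Suc[of x] by (simp flip: V_Suc)
      show "1 / 2 * (norm x)\<^sup>2 \<le> inner (V (Suc (Suc n)) x) x" for x
      proof -
        have "pi / 2 ^ Suc (Suc n) \<le> pi / 4"
          by (intro divide_left_mono) (auto simp: mult_le_cancel_right1)
        then have "pi / 2 ^ Suc (Suc n) \<le> 1" using pi_less_4 by linarith
        then have "(pi / 2 ^ Suc (Suc n))\<^sup>2 \<le> 1" by (intro power_le_one) auto
        then have "1 / 2 * (norm x)\<^sup>2 \<le> (1 - (pi / 2 ^ Suc (Suc n))\<^sup>2 / 2) * (norm x)\<^sup>2"
          by (intro mult_right_mono) auto
        also have "\<dots> \<le> inner (V (Suc (Suc n)) x) x" by (rule inner_V_ge[OF Y_le])
        finally show ?thesis .
      qed
    qed (use bl in \<open>auto simp: V_linear norm_V bounded_linear_ident\<close>)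
  qed (use V1 in simp)
  have "Y (Z' y) = Z' (Y y)" for y
  proof (rule commute_if_commute_V[OF bl, of 1])
    show "V n (Z' y) = Z' (V n y)" if "1 \<le> n" for n
      using V_Z'[of "n - 1"] that by simp
  qed
  then show ?thesis by (simp add: Z'_def P_Y linear_simps[OF Y])
qed

end

lemma cis_vimage_minus_one: "cis -` {-1} = {(2 * of_int k + 1) * pi | k::int. True}"
proof -
  have "cis t = -1 \<longleftrightarrow> (\<exists>k::int. t = pi + 2 * of_int k * pi)" for t
    using cis_eq_cis_iff[of t pi] by simp
  then show ?thesis by (auto simp: algebra_simps)
qed

theorem theorem5p1:
  fixes E :: "real set \<Rightarrow> 'a::chilbert \<Rightarrow> 'a"
    and D :: "'a set" and X :: "'a \<Rightarrow> 'a" and Y :: "'a \<Rightarrow> 'a"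
  assumes sa: "self_adjoint D X"
    and EX: "spectral_measure_of E D X"
    and Yb: "bop Y"
    and expeq: "spectral_integral E (\<lambda>t. cis t) (op_exp Y)"
  shows "(gen_2pi_congruence_free E D X \<longrightarrow>
            (\<forall>\<Omega>\<in>sets borel. E \<Omega> \<in> commutant (commutant {Y})) \<and> commutes_sa E Y)
       \<and> ((\<forall>a b. a \<in> {(2 * of_int k + 1) * pi | k::int. True} \<inter> point_spectrum D X
                 \<longrightarrow> b \<in> {(2 * of_int k + 1) * pi | k::int. True} \<inter> point_spectrum D X
                 \<longrightarrow> a = b)
           \<and> normal_op Y \<and> bspectrum Y \<subseteq> {z. - pi \<le> Im z \<and> Im z \<le> pi}
           \<longrightarrow> commutes_sa E Y)
       \<and> ((\<forall>k::int. (2 * of_int k + 1) * pi \<notin> point_spectrum D X)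
           \<and> normal_op Y \<and> bspectrum Y \<subseteq> {z. - pi \<le> Im z \<and> Im z \<le> pi}
           \<longrightarrow> Y \<in> commutant (commutant {op_exp Y}))"
proof (intro conjI impI; (elim conjE)?)
  interpret self_adjoint_resolution E D X by unfold_locales (fact sa EX)+
  interpret exponential_resolution E "op_exp Y" by unfold_locales (fact expeq)
  interpret self_adjoint_exponential E D X "op_exp Y" by unfold_locales
  let ?odd = "{(2 * of_int k + 1) * pi | k::int. True}" and ?P = "E (cis -` {-1})"
  have bl: "bounded_linear Y" by (rule bop_bounded_linear[OF Yb])
  \<comment> \<open>What commutes with \<open>Y\<close> commutes with its exponential, so results on
    the commutant of the unitary apply.\<close>
  have exp_commute: "Z (op_exp Y x) = op_exp Y (Z x)" if "Z \<in> commutant {Y}" for Z x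
    using that by (intro op_exp_commute[OF bl]) (auto simp: commutant_def bop_def fun_eq_iff)
  have Y_comm: "Y \<in> commutant {Y}" using Yb by (simp add: commutant_def)
  have P: "cis -` {-1} \<in> sets borel"
    by (rule measurable_sets_borel[OF cis_measurable]) simp
  {
    assume gcf: "gen_2pi_congruence_free E D X"
    have comm: "Z (E A x) = E A (Z x)" if "A \<in> sets borel" "Z \<in> commutant {Y}" for A Z x
      using that exp_commute by (intro E_commuting[OF gcf]) (auto simp: commutant_def)
    then show "\<forall>\<Omega>\<in>sets borel. E \<Omega> \<in> commutant (commutant {Y})"
      unfolding commutant_def[of "commutant {Y}"] by (auto simp: bop_E fun_eq_iff)
    show "commutes_sa E Y"
      using comm Y_comm by (auto simp: commutes_sa_def fun_eq_iff)
  }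
  assume normal: "normal_op Y" and spec: "bspectrum Y \<subseteq> {z. - pi \<le> Im z \<and> Im z \<le> pi}"
  have skew: "inner (Y x) y = - inner x (Y y)" for x y
    by (rule normal_skew_if_op_exp_isometry[OF normal norm_U])
  interpret skew_logarithm E Y
    by (intro skew_logarithm.intro skew_logarithm_axioms.intro exponential_resolution_axioms
        skew_operator.intro bl skew Yb norm_le_pi_if_bspectrum[OF Yb skew spec])
  {
    assume one: "\<forall>a b. a \<in> ?odd \<inter> point_spectrum D X \<longrightarrow> b \<in> ?odd \<inter> point_spectrum D X \<longrightarrow> a = b"
    \<comment> \<open>A default for \<open>a\<close> when no odd multiple of \<pi> is an
      eigenvalue.\<close>
    have "pi \<in> ?odd" by (auto intro!: exI[of _ "0::int"])
    then obtain a where a: "a \<in> ?odd" and unique: "?odd \<inter> point_spectrum D X \<subseteq> {a}"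
      using one by (cases "?odd \<inter> point_spectrum D X = {}") blast+
    \<comment> \<open>The odd multiples other than \<open>a\<close> are countably many
      non-eigenvalues, hence null.\<close>
    have P_eq: "?P x = E {a} x" for x
    proof -
      have "E (?odd - {a}) x = 0"
        by (rule E_countable_eq_zero) (use unique in \<open>auto simp: full_SetCompr_eq\<close>)
      moreover have "E ({a} \<union> (?odd - {a})) x = E {a} x + E (?odd - {a}) x"
        by (rule E_Un) (use P in \<open>auto simp: cis_vimage_minus_one\<close>)
      moreover have "{a} \<union> (?odd - {a}) = ?odd" using a by blast
      ultimately show ?thesis by (simp add: cis_vimage_minus_one)
    qed
    show "commutes_sa E Y"
      unfolding commutes_sa_def fun_eq_iff comp_def
    proof (intro ballI allI)
      fix A :: "real set" and x assume A: "A \<in> sets borel"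
      have YP: "Y (?P y) = ?P (Y y)" for y
        using E_commuting_closed[OF Yb Y_exp_commute, of "{-1}"] by simp
      \<comment> \<open>Since \<open>?P\<close> belongs to a single point, \<open>E A\<close> acts
        on its range as 1 or 0; this covers the subspace that \<open>commute_off_minus_one\<close>
        leaves out.\<close>
      obtain c where c: "E A (?P y) = c *\<^sub>R ?P y" for y
      proof (cases "a \<in> A")
        case True
        then show ?thesis using that[of 1] A by (simp add: P_eq E_Int)
      next
        case False
        then show ?thesis using that[of 0] A by (simp add: P_eq E_Int)
      qed
      have U: "E A (op_exp Y y) = op_exp Y (E A y)" for y by (rule E_U[OF A])
      \<comment> \<open>Off the eigenspace \<open>commute_off_minus_one\<close> applies with
        \<open>Z = E A\<close>; inside it \<open>E A\<close> is the scalar \<open>c\<close>.\<close>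
      have "Y (E A x) = Y (E A (x - ?P x)) + Y (E A (?P x))"
        using A by (simp add: E_linear linear_simps[OF bl])
      also have "\<dots> = E A (Y (x - ?P x)) + E A (Y (?P x))"
        by (simp add: commute_off_minus_one[OF bop_E[OF A] U] c YP linear_simps[OF bl])
      also have "\<dots> = E A (Y x)" using A by (simp add: E_linear linear_simps[OF bl])
      finally show "Y (E A x) = E A (Y x)" .
    qed
  }
  assume none: "\<forall>k::int. (2 * of_int k + 1) * pi \<notin> point_spectrum D X"
  \<comment> \<open>With \<open>?P\<close> zero, \<open>commute_off_minus_one\<close> gives
    commutation on the whole space.\<close>
  have P0: "?P x = 0" for x
    unfolding cis_vimage_minus_one
    by (rule E_countable_eq_zero) (use none in \<open>auto simp: full_SetCompr_eq\<close>)
  have "Y (Z x) = Z (Y x)" if "Z \<in> commutant {op_exp Y}" for Z x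
    using commute_off_minus_one[of Z x] that by (auto simp: commutant_def P0 fun_eq_iff)
  then show "Y \<in> commutant (commutant {op_exp Y})"
    unfolding commutant_def[of "commutant {op_exp Y}"] using Yb by (auto simp: fun_eq_iff)
qed

end
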